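(* There exist a finite alphabet $\Sigma$ and a rational subset $\mathcal{R}\subseteq F(\Sigma)$ such that $\mathrm{PCP}_{\mathcal{R}}$, the Post Correspondence Problem for free groups under the rational constraint $\mathcal{R}$, is undecidable; that is, there is no algorithm which, given a finite alphabet $\Delta$ and homomorphisms $g,h:F(\Sigma)\to F(\Delta)$, decides whether there is $x\in\mathcal{R}$ with $x\neq 1$ and $g(x)=h(x)$.
   Context: $F(\Sigma)$ is the free group on $\Sigma$; homomorphisms are given by the images of the generators. A subset of $F(\Sigma)$ is rational if it is the image, under the natural projection $(\Sigma\cup\Sigma^{-1})^*\to F(\Sigma)$, of a regular language. *)

theory Defs
  imports "HOL-Algebra.Group" "HOL-Library.Nat_Bijection"
begin

section \<open>Free groups\<close>

text \<open>The letter \<open>(a, True)\<close> stands for the generator \<open>a\<close>, and \<open>(a, False)\<close> for its formal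
  inverse. The elements of the free group are the freely reduced words, so \<open>free_reduce\<close> is
  the natural projection from words to the free group.\<close>

type_synonym 'a letter = "'a \<times> bool"

definition letters :: "'a set \<Rightarrow> 'a letter set" where
  "letters \<Sigma> = \<Sigma> \<times> UNIV"

fun inv_letter :: "'a letter \<Rightarrow> 'a letter" where
  "inv_letter (a, e) = (a, \<not> e)"

fun push_letter :: "'a letter \<Rightarrow> 'a letter list \<Rightarrow> 'a letter list" where
  "push_letter x [] = [x]"
| "push_letter x (y # ys) = (if y = inv_letter x then ys else x # y # ys)"

definition free_reduce :: "'a letter list \<Rightarrow> 'a letter list" where
  "free_reduce w = foldr push_letter w []"

definition freely_reduced :: "'a letter list \<Rightarrow> bool" where
  "freely_reduced w \<longleftrightarrow> successively (\<lambda>x y. y \<noteq> inv_letter x) w"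

definition free_group :: "'a set \<Rightarrow> 'a letter list monoid" where
  "free_group \<Sigma> = \<lparr>carrier = {w \<in> lists (letters \<Sigma>). freely_reduced w},
     mult = (\<lambda>u v. free_reduce (u @ v)), one = []\<rparr>"

lemma inv_letter_inv_letter [simp]: "inv_letter (inv_letter x) = x"
  by (cases x) simp

lemma inv_letter_neq [simp]: "inv_letter x \<noteq> x" "x \<noteq> inv_letter x"
  by (cases x, simp)+

lemma inv_letter_in_letters [simp]: "inv_letter x \<in> letters \<Sigma> \<longleftrightarrow> x \<in> letters \<Sigma>"
  by (cases x) (simp add: letters_def)

lemma freely_reduced_Nil [simp]: "freely_reduced []"
  and freely_reduced_singleton [simp]: "freely_reduced [x]"
  and freely_reduced_Cons_Cons:
    "freely_reduced (x # y # ys) \<longleftrightarrow> y \<noteq> inv_letter x \<and> freely_reduced (y # ys)"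
  by (simp_all add: freely_reduced_def)

lemma freely_reduced_tl: "freely_reduced (x # w) \<Longrightarrow> freely_reduced w"
  by (cases w) (simp_all add: freely_reduced_Cons_Cons)

lemma push_letter_reduced: "freely_reduced (x # w) \<Longrightarrow> push_letter x w = x # w"
  by (cases w) (simp_all add: freely_reduced_Cons_Cons)

lemma freely_reduced_push: "freely_reduced w \<Longrightarrow> freely_reduced (push_letter x w)"
  by (cases w) (auto simp: freely_reduced_Cons_Cons dest: freely_reduced_tl)

lemma push_push_inv: "freely_reduced w \<Longrightarrow> push_letter x (push_letter (inv_letter x) w) = w"
  by (cases w) (auto simp: push_letter_reduced)

lemma freely_reduced_foldr: "freely_reduced w \<Longrightarrow> freely_reduced (foldr push_letter u w)"
  by (induction u) (simp_all add: freely_reduced_push)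

lemma freely_reduced_free_reduce [simp]: "freely_reduced (free_reduce w)"
  by (simp add: free_reduce_def freely_reduced_foldr)

lemma free_reduce_id: "freely_reduced w \<Longrightarrow> free_reduce w = w"
proof (induction w)
  case (Cons x w)
  then have "free_reduce w = w" using freely_reduced_tl by blast
  then show ?case using Cons.prems push_letter_reduced by (simp add: free_reduce_def)
qed (simp add: free_reduce_def)

lemma foldr_push_push:
  assumes "freely_reduced w"
  shows "foldr push_letter (push_letter x u) w = push_letter x (foldr push_letter u w)"
proof (cases u)
  case (Cons y ys)
  then show ?thesis
    using push_push_inv[OF freely_reduced_foldr[OF assms, of ys], of x] by auto
qed simp

lemma foldr_push_free_reduce:
  "freely_reduced w \<Longrightarrow> foldr push_letter (free_reduce u) w = foldr push_letter u w"
  unfolding free_reduce_def by (induction u) (simp_all add: foldr_push_push)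

lemma free_reduce_append_left [simp]: "free_reduce (free_reduce u @ v) = free_reduce (u @ v)"
  using foldr_push_free_reduce[of "free_reduce v" u]
  by (simp add: free_reduce_def freely_reduced_foldr)

lemma free_reduce_append_right [simp]: "free_reduce (u @ free_reduce v) = free_reduce (u @ v)"
  using free_reduce_id[OF freely_reduced_free_reduce, of v] by (simp add: free_reduce_def)

lemma push_letter_in_lists:
  "x \<in> letters \<Sigma> \<Longrightarrow> w \<in> lists (letters \<Sigma>) \<Longrightarrow> push_letter x w \<in> lists (letters \<Sigma>)"
  by (cases w) auto

lemma free_reduce_in_lists: "w \<in> lists (letters \<Sigma>) \<Longrightarrow> free_reduce w \<in> lists (letters \<Sigma>)"
  unfolding free_reduce_def
proof (induction w)
  case (Cons x w)
  then show ?case using push_letter_in_lists[of x \<Sigma>] by auto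
qed simp

lemma free_reduce_in_carrier:
  "w \<in> lists (letters \<Sigma>) \<Longrightarrow> free_reduce w \<in> carrier (free_group \<Sigma>)"
  using free_reduce_in_lists by (auto simp: free_group_def)

lemma free_reduce_rev_inv: "free_reduce (rev (map inv_letter w) @ w) = []"
proof (induction w)
  case (Cons x w)
  have "free_reduce (inv_letter x # x # w) = free_reduce w"
    using push_push_inv[of "free_reduce w" "inv_letter x"]
    by (simp add: free_reduce_def freely_reduced_foldr)
  then have "free_reduce (rev (map inv_letter w) @ inv_letter x # x # w)
      = free_reduce (rev (map inv_letter w) @ w)"
    by (metis free_reduce_append_right)
  with Cons.IH show ?case by simp
qed (simp add: free_reduce_def)

lemma group_free_group: "group (free_group \<Sigma>)"
proof (rule groupI)
  fix u assume u: "u \<in> carrier (free_group \<Sigma>)"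
  let ?v = "free_reduce (rev (map inv_letter u))"
  have "?v \<in> carrier (free_group \<Sigma>)"
    using u by (intro free_reduce_in_carrier)
      (auto simp: free_group_def simp del: inv_letter.simps)
  moreover have "?v \<otimes>\<^bsub>free_group \<Sigma>\<^esub> u = \<one>\<^bsub>free_group \<Sigma>\<^esub>"
    by (simp add: free_group_def free_reduce_rev_inv)
  ultimately show "\<exists>v\<in>carrier (free_group \<Sigma>). v \<otimes>\<^bsub>free_group \<Sigma>\<^esub> u = \<one>\<^bsub>free_group \<Sigma>\<^esub>"
    by blast
next
  fix u v assume "u \<in> carrier (free_group \<Sigma>)" "v \<in> carrier (free_group \<Sigma>)"
  then have "u @ v \<in> lists (letters \<Sigma>)"
    by (simp add: free_group_def)
  then show "u \<otimes>\<^bsub>free_group \<Sigma>\<^esub> v \<in> carrier (free_group \<Sigma>)"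
    using free_reduce_in_carrier[of "u @ v" \<Sigma>] by (simp add: free_group_def)
qed (simp_all add: free_group_def free_reduce_id)

lemma free_group_mult_singleton:
  "free_reduce (x # w) = [x] \<otimes>\<^bsub>free_group \<Sigma>\<^esub> free_reduce w"
  using free_reduce_append_right[of "[x]" w] by (simp add: free_group_def)

text \<open>Homomorphisms from \<open>F(\<Sigma>)\<close> are determined by the images of the generators.\<close>

lemma free_group_hom_eqI:
  assumes "group G" and g: "g \<in> hom (free_group \<Sigma>) G" and h: "h \<in> hom (free_group \<Sigma>) G"
    and gen: "\<And>a. a \<in> \<Sigma> \<Longrightarrow> g [(a, True)] = h [(a, True)]"
    and x: "x \<in> carrier (free_group \<Sigma>)"
  shows "g x = h x"
proof -
  let ?F = "free_group \<Sigma>"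
  interpret g: group_hom ?F G g
    using assms by (simp add: group_hom_def group_hom_axioms_def group_free_group)
  interpret h: group_hom ?F G h
    using assms by (simp add: group_hom_def group_hom_axioms_def group_free_group)
  have letter: "g [y] = h [y]" if "y \<in> letters \<Sigma>" for y
  proof (cases y)
    case (Pair a e)
    then have a: "a \<in> \<Sigma>" using that by (simp add: letters_def)
    have c: "[(a, b)] \<in> carrier ?F" for b
      using a by (simp add: free_group_def letters_def)
    have "[(a, False)] \<otimes>\<^bsub>?F\<^esub> [(a, True)] = \<one>\<^bsub>?F\<^esub>"
      by (simp add: free_group_def free_reduce_def)
    then have "[(a, False)] = inv\<^bsub>?F\<^esub> [(a, True)]"
      using c by (simp add: group.inv_equality[OF group_free_group])
    then show ?thesis
      using Pair gen[OF a] c g.hom_inv h.hom_inv by (cases e) simp_all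
  qed
  have "g (free_reduce w) = h (free_reduce w)" if "w \<in> lists (letters \<Sigma>)" for w
    using that
  proof (induction w)
    case Nil
    then show ?case
      using g.hom_one h.hom_one by (simp add: free_reduce_def free_group_def)
  next
    case (Cons y w)
    then have "[y] \<in> carrier ?F" "free_reduce w \<in> carrier ?F"
      using free_reduce_in_carrier by (auto simp: free_group_def)
    then show ?case
      using Cons letter[of y] by (simp add: free_group_mult_singleton[of y w \<Sigma>])
  qed
  moreover have "x \<in> lists (letters \<Sigma>)" "free_reduce x = x"
    using x by (auto simp: free_group_def free_reduce_id)
  ultimately show ?thesis by metis
qed


section \<open>Rational subsets\<close>

text \<open>A language is regular if some deterministic finite automaton recognises it; the states
  are taken to be \<open>0, \<dots>, n - 1\<close>.\<close>

definition regular_language :: "'b set \<Rightarrow> 'b list set \<Rightarrow> bool" where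
  "regular_language A L \<longleftrightarrow> finite A \<and>
     (\<exists>(n::nat) \<delta> q\<^sub>0 Q. (\<forall>q<n. \<forall>a\<in>A. \<delta> q a < n) \<and> q\<^sub>0 < n \<and> Q \<subseteq> {..<n} \<and>
        L = {w \<in> lists A. foldl \<delta> q\<^sub>0 w \<in> Q})"

definition rational_subset :: "'a set \<Rightarrow> 'a letter list set \<Rightarrow> bool" where
  "rational_subset \<Sigma> R \<longleftrightarrow> (\<exists>L. regular_language (letters \<Sigma>) L \<and> R = free_reduce ` L)"

lemma rational_subset_carrier: "rational_subset \<Sigma> R \<Longrightarrow> R \<subseteq> carrier (free_group \<Sigma>)"
  using free_reduce_in_carrier by (fastforce simp: rational_subset_def regular_language_def)


section \<open>Partial recursive functions\<close>

text \<open>\<open>rec_eval f xs y\<close>: the partial recursive function described by \<open>f\<close> is defined on the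
  argument tuple \<open>xs\<close> and has the value \<open>y\<close>. In \<open>Prim\<close> and \<open>Mu\<close> the recursion variable and
  the search variable are the first argument.\<close>

datatype recf = Zero | Succ | Proj nat | Comp recf "recf list" | Prim recf recf | Mu recf

inductive rec_eval :: "recf \<Rightarrow> nat list \<Rightarrow> nat \<Rightarrow> bool" where
  Zero: "rec_eval Zero xs 0"
| Succ: "rec_eval Succ [x] (Suc x)"
| Proj: "i < length xs \<Longrightarrow> rec_eval (Proj i) xs (xs ! i)"
| Comp: "list_all2 (\<lambda>g y. rec_eval g xs y) gs ys \<Longrightarrow> rec_eval f ys z \<Longrightarrow> rec_eval (Comp f gs) xs z"
| Prim_0: "rec_eval f xs y \<Longrightarrow> rec_eval (Prim f g) (0 # xs) y"
| Prim_Suc: "rec_eval (Prim f g) (n # xs) r \<Longrightarrow> rec_eval g (n # r # xs) y \<Longrightarrow>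
    rec_eval (Prim f g) (Suc n # xs) y"
| Mu: "rec_eval f (n # xs) 0 \<Longrightarrow> (\<And>m. m < n \<Longrightarrow> \<exists>k. rec_eval f (m # xs) (Suc k)) \<Longrightarrow>
    rec_eval (Mu f) xs n"

inductive_cases rec_eval_ZeroE: "rec_eval Zero xs y"
  and rec_eval_SuccE: "rec_eval Succ xs y"
  and rec_eval_ProjE: "rec_eval (Proj i) xs y"
  and rec_eval_CompE: "rec_eval (Comp f gs) xs y"
  and rec_eval_Prim_0E: "rec_eval (Prim f g) (0 # xs) y"
  and rec_eval_Prim_SucE: "rec_eval (Prim f g) (Suc n # xs) y"
  and rec_eval_MuE: "rec_eval (Mu f) xs y"

lemma rec_eval_deterministic: "rec_eval f xs y \<Longrightarrow> rec_eval f xs z \<Longrightarrow> y = z"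
proof (induction arbitrary: z rule: rec_eval.induct)
  case (Comp xs gs ys f y)
  from Comp.prems obtain ys' where ys': "list_all2 (\<lambda>g y. rec_eval g xs y) gs ys'"
    and f: "rec_eval f ys' z"
    by (rule rec_eval_CompE)
  have "ys = ys'"
    using Comp.IH(1) ys' by (auto simp: list_all2_conv_all_nth intro: nth_equalityI)
  with f Comp.IH(2) show ?case by blast
next
  case (Prim_Suc f g n xs r y)
  from Prim_Suc.prems obtain r' where "rec_eval (Prim f g) (n # xs) r'"
    and z: "rec_eval g (n # r' # xs) z"
    by (rule rec_eval_Prim_SucE)
  then have "r = r'" using Prim_Suc.IH(1) by blast
  with z Prim_Suc.IH(2) show ?case by blast
next
  case (Mu f n xs)
  from Mu.prems obtain z: "rec_eval f (z # xs) 0"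
    and below: "\<And>m. m < z \<Longrightarrow> \<exists>k. rec_eval f (m # xs) (Suc k)"
    by (rule rec_eval_MuE) blast
  have "\<not> n < z" using below Mu.IH(1) by fastforce
  moreover have "\<not> z < n" using z Mu.IH(2) by fastforce
  ultimately show ?case by simp
next
  case (Prim_0 f xs y g)
  from Prim_0.prems have "rec_eval f xs z" by (rule rec_eval_Prim_0E)
  with Prim_0.IH show ?case by blast
qed (auto elim: rec_eval_ZeroE rec_eval_SuccE rec_eval_ProjE)


section \<open>The Post Correspondence Problem with a rational constraint\<close>

text \<open>An instance \<open>(\<Delta>, g, h)\<close> is presented to an algorithm as the number coding \<open>\<Delta>\<close> and the two
  lists of images (as reduced words) of the generators, in increasing order of the generators.
  Letters of alphabets are natural numbers.\<close>

definition word_code :: "nat letter list \<Rightarrow> nat" where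
  "word_code w = list_encode (map (\<lambda>(a, e). prod_encode (a, of_bool e)) w)"

definition hom_code :: "nat set \<Rightarrow> (nat letter list \<Rightarrow> nat letter list) \<Rightarrow> nat" where
  "hom_code \<Sigma> g = list_encode (map (\<lambda>a. word_code (g [(a, True)])) (sorted_list_of_set \<Sigma>))"

definition pcp_code ::
  "nat set \<Rightarrow> nat set \<Rightarrow> (nat letter list \<Rightarrow> nat letter list) \<Rightarrow>
     (nat letter list \<Rightarrow> nat letter list) \<Rightarrow> nat" where
  "pcp_code \<Sigma> \<Delta> g h = prod_encode (set_encode \<Delta>, prod_encode (hom_code \<Sigma> g, hom_code \<Sigma> h))"

definition pcp_solvable ::
  "nat set \<Rightarrow> nat letter list set \<Rightarrow> (nat letter list \<Rightarrow> nat letter list) \<Rightarrow>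
     (nat letter list \<Rightarrow> nat letter list) \<Rightarrow> bool" where
  "pcp_solvable \<Sigma> R g h \<longleftrightarrow> (\<exists>x\<in>R. x \<noteq> \<one>\<^bsub>free_group \<Sigma>\<^esub> \<and> g x = h x)"

text \<open>Nothing is required of the algorithm on numbers that do not code an instance.\<close>

definition pcp_decidable :: "nat set \<Rightarrow> nat letter list set \<Rightarrow> bool" where
  "pcp_decidable \<Sigma> R \<longleftrightarrow>
     (\<exists>f. \<forall>\<Delta> g h. finite \<Delta> \<longrightarrow>
        g \<in> hom (free_group \<Sigma>) (free_group \<Delta>) \<longrightarrow> h \<in> hom (free_group \<Sigma>) (free_group \<Delta>) \<longrightarrow>
        rec_eval f [pcp_code \<Sigma> \<Delta> g h] (of_bool (pcp_solvable \<Sigma> R g h)))"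

text \<open>The code of an instance determines the instance.\<close>

lemma word_code_inject [simp]: "word_code u = word_code v \<longleftrightarrow> u = v"
proof -
  have "inj (\<lambda>(a::nat, e). prod_encode (a, of_bool e))"
    by (auto simp: inj_def)
  then show ?thesis
    by (simp add: word_code_def list_encode_eq)
qed

lemma pcp_code_inject:
  assumes "finite \<Sigma>" "finite \<Delta>" "finite \<Delta>'"
    and "g \<in> hom (free_group \<Sigma>) (free_group \<Delta>)" "h \<in> hom (free_group \<Sigma>) (free_group \<Delta>)"
    and "g' \<in> hom (free_group \<Sigma>) (free_group \<Delta>')" "h' \<in> hom (free_group \<Sigma>) (free_group \<Delta>')"
    and code: "pcp_code \<Sigma> \<Delta> g h = pcp_code \<Sigma> \<Delta>' g' h'"
  shows "\<Delta> = \<Delta>'" and "\<forall>x\<in>carrier (free_group \<Sigma>). g x = g' x \<and> h x = h' x"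
proof -
  show \<Delta>: "\<Delta> = \<Delta>'"
    using code assms(2,3) by (simp add: pcp_code_def set_encode_eq)
  have "\<forall>a\<in>\<Sigma>. g [(a, True)] = g' [(a, True)] \<and> h [(a, True)] = h' [(a, True)]"
    using code \<open>finite \<Sigma>\<close> by (auto simp: pcp_code_def hom_code_def list_encode_eq)
  then show "\<forall>x\<in>carrier (free_group \<Sigma>). g x = g' x \<and> h x = h' x"
    using assms(4-7) free_group_hom_eqI[OF group_free_group, of g \<Sigma> \<Delta> g']
      free_group_hom_eqI[OF group_free_group, of h \<Sigma> \<Delta> h'] unfolding \<Delta> by blast
qed

end

theory Submission
  imports Defs
begin

text \<open>The problem for positive words already encodes reachability in a fixed string
  rewriting system. Let \<open>R\<close> consist of the positive words
  \<open>Init s\<^sub>1 Hash s\<^sub>2 Hash \<dots> Hash e Fin\<close>, where each \<open>s\<^sub>i\<close> spells out a rewriting pass over a word: if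
  \<open>g\<close> writes the result of the pass that \<open>h\<close> reads, and \<open>g(Init)\<close> is a word \<open>w\<close>, then \<open>g(x) = h(x)\<close> says
  that \<open>x\<close> is a computation history of the system starting from \<open>w\<close>. Only \<open>g(Init)\<close> depends on the
  instance.

  The fixed rewriting system is an interpreter of counter machines, whose program is part of the
  word. A recursive function description \<open>p\<close> is compiled, by an arbitrary meta-level function, into
  such a program, and its argument \<open>x\<close> is the unary content of the first counter. Undecidability
  follows by diagonalisation: \<open>x\<close> is chosen as the code of the program part of the initial word, so
  that the code of the instance is a simple recursive function of \<open>x\<close>.\<close>

section \<open>Register programs for recursive functions\<close>

text \<open>Positive words are freely reduced, so once \<open>R\<close> and the images of the
  generators are positive, \<open>g x = h x\<close> is an equality of words; and \<open>x\<close> is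
  nontrivial because it begins with \<open>Init\<close>. The difficulty is that
  \<open>\<Sigma>\<close> and \<open>R\<close> are fixed before the machine to be simulated, so that
  finitely many rules must handle any number of registers, states and program lines. Registers
  therefore become tape cells that are reached by walking. Jumps become guesses: the program pointer
  may go to any block, and each block opens with a decrement that is stuck unless the control state
  is the right one. This is harmless because only the existence of a derivation matters. For the
  same reason each layer is given by a relation in which a wrong choice is a stuck run, and the
  layers are linked by equivalences: an undefined value must leave no accepting run at all. Rules
  act on two sites because an instruction and the cell that it changes may be arbitrarily far apart
  in the word.\<close>

type_synonym vec = "nat \<Rightarrow> nat"

datatype op = Inc nat | Dec nat | Tst nat

fun op_sem :: "op \<Rightarrow> vec \<Rightarrow> vec \<Rightarrow> bool" where
  "op_sem (Inc r) v v' \<longleftrightarrow> v' = v(r := Suc (v r))"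
| "op_sem (Dec r) v v' \<longleftrightarrow> 0 < v r \<and> v' = v(r := v r - 1)"
| "op_sem (Tst r) v v' \<longleftrightarrow> v r = 0 \<and> v' = v"

fun ops_sem :: "op list \<Rightarrow> vec \<Rightarrow> vec \<Rightarrow> bool" where
  "ops_sem [] v v' \<longleftrightarrow> v' = v"
| "ops_sem (x # xs) v v' \<longleftrightarrow> (\<exists>w. op_sem x v w \<and> ops_sem xs w v')"

datatype com = Ops "op list" | Seq com com | Loop nat com

fun sem :: "com \<Rightarrow> vec \<Rightarrow> vec \<Rightarrow> bool" where
  "sem (Ops xs) v v' \<longleftrightarrow> ops_sem xs v v'"
| "sem (Seq c d) v v' \<longleftrightarrow> (\<exists>w. sem c v w \<and> sem d w v')"
| "sem (Loop r c) v v' \<longleftrightarrow>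
     (\<lambda>v v'. 0 < v r \<and> sem c (v(r := v r - 1)) v')\<^sup>*\<^sup>* v v' \<and> v' r = 0"

declare sem.simps(3) [simp del]

lemma sem_Loop:
  "sem (Loop r c) v v' \<longleftrightarrow>
     (if v r = 0 then v' = v else \<exists>w. sem c (v(r := v r - 1)) w \<and> sem (Loop r c) w v')"
  (is "?l \<longleftrightarrow> ?r")
proof
  let ?R = "\<lambda>v v'. 0 < v r \<and> sem c (v(r := v r - 1)) v'"
  assume ?l
  then have "?R\<^sup>*\<^sup>* v v'" and 0: "v' r = 0" by (simp_all add: sem.simps(3))
  from this(1) show ?r
    by (cases rule: converse_rtranclpE) (use 0 in \<open>auto simp: sem.simps(3)\<close>)
qed (auto simp: sem.simps(3) split: if_splits intro: converse_rtranclp_into_rtranclp)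

text \<open>The two rules for symbolic execution: once the first command is characterised by an
  equation, possibly up to an existential result, the second one starts in a known state.\<close>

lemma sem_Seq_det: "(\<And>w. sem c v w \<longleftrightarrow> w = u) \<Longrightarrow> sem (Seq c d) v v' \<longleftrightarrow> sem d u v'"
  by auto

lemma sem_Seq_ex:
  "(\<And>w. sem c v w \<longleftrightarrow> (\<exists>y. P y \<and> w = u y)) \<Longrightarrow> sem (Seq c d) v v' \<longleftrightarrow> (\<exists>y. P y \<and> sem d (u y) v')"
  by auto

section \<open>Clearing, moving and copying registers\<close>

definition clear :: "nat \<Rightarrow> com" where
  "clear r = Loop r (Ops [])"

definition move :: "nat \<Rightarrow> nat \<Rightarrow> com" where
  "move a d = Loop a (Ops [Inc d])"

definition copy :: "nat \<Rightarrow> nat \<Rightarrow> nat \<Rightarrow> com" where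
  "copy a d t = Seq (Loop a (Ops [Inc d, Inc t])) (move t a)"

fun clears :: "nat \<Rightarrow> nat \<Rightarrow> com" where
  "clears s 0 = Ops []"
| "clears s (Suc m) = Seq (clear s) (clears (Suc s) m)"

lemma sem_clear: "sem (clear r) v v' \<longleftrightarrow> v' = v(r := 0)"
  unfolding clear_def
proof (induction "v r" arbitrary: v)
  case 0
  then show ?case by (subst sem_Loop) (auto simp: fun_upd_idem)
next
  case (Suc n)
  then show ?case by (subst sem_Loop) auto
qed

lemma sem_move: "a \<noteq> d \<Longrightarrow> sem (move a d) v v' \<longleftrightarrow> v' = v(a := 0, d := v d + v a)"
  unfolding move_def
proof (induction "v a" arbitrary: v)
  case 0
  then show ?case by (subst sem_Loop) (auto simp: fun_upd_idem)
next
  case (Suc n)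
  then show ?case by (subst sem_Loop) (auto simp: fun_upd_twist)
qed

lemma sem_copy:
  assumes "a \<noteq> d" "a \<noteq> t" "d \<noteq> t" "v t = 0"
  shows "sem (copy a d t) v v' \<longleftrightarrow> v' = v(d := v d + v a)"
proof -
  have loop: "sem (Loop a (Ops [Inc d, Inc t])) v v' \<longleftrightarrow>
      v' = v(a := 0, d := v d + v a, t := v t + v a)" for v v'
    using assms(1-3)
  proof (induction "v a" arbitrary: v)
    case 0
    then show ?case by (subst sem_Loop) (auto simp: fun_upd_idem)
  next
    case (Suc n)
    then show ?case by (subst sem_Loop) (auto simp: fun_upd_twist)
  qed
  have "v(a := 0, d := v d + v a, t := 0, a := v a) = v(d := v d + v a)"
    using assms by (simp add: fun_eq_iff)
  then show ?thesis
    using assms by (simp add: copy_def loop sem_move)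
qed

lemma sem_clears: "sem (clears s m) v v' \<longleftrightarrow> v' = (\<lambda>r. if s \<le> r \<and> r < s + m then 0 else v r)"
proof (induction m arbitrary: s v)
  case (Suc m)
  have "(\<lambda>r. if Suc s \<le> r \<and> r < Suc s + m then 0 else (v(s := 0)) r) =
      (\<lambda>r. if s \<le> r \<and> r < s + Suc m then 0 else v r)"
    by (auto simp: fun_eq_iff)
  then show ?case
    unfolding clears.simps sem_Seq_det[OF sem_clear] Suc.IH by simp
qed (simp add: fun_eq_iff)

text \<open>\<open>trans f as d s\<close> adds to register \<open>d\<close> the value of \<open>f\<close> on the contents of the registers
  \<open>as\<close>; the registers from \<open>s\<close> on are scratch space. The command \<open>Ops [Dec s]\<close> is stuck, as
  scratch registers are \<open>0\<close>.\<close>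

fun trans :: "recf \<Rightarrow> nat list \<Rightarrow> nat \<Rightarrow> nat \<Rightarrow> com"
  and transs :: "recf list \<Rightarrow> nat list \<Rightarrow> nat \<Rightarrow> nat \<Rightarrow> com" where
  "trans Zero as d s = Ops []"
| "trans Succ as d s =
     (if length as = 1 then Seq (copy (hd as) d s) (Ops [Inc d]) else Ops [Dec s])"
| "trans (Proj i) as d s = (if i < length as then copy (as ! i) d s else Ops [Dec s])"
| "trans (Comp f gs) as d s =
     Seq (transs gs as s (s + length gs))
       (Seq (trans f [s..<s + length gs] d (s + length gs)) (clears s (length gs)))"
| "trans (Prim f g) as d s =
     (case as of [] \<Rightarrow> Ops [Dec s] | a # as' \<Rightarrow>
       Seq (copy a s (s + 1)) (Seq (trans f as' (s + 1) (s + 2))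
         (Seq (Loop s (Seq (trans g ((s + 2) # (s + 1) # as') (s + 3) (s + 4))
                (Seq (clear (s + 1)) (Seq (move (s + 3) (s + 1)) (Ops [Inc (s + 2)])))))
           (Seq (move (s + 1) d) (clear (s + 2))))))"
| "trans (Mu f) as d s =
     Seq (trans f (s # as) (s + 1) (s + 2))
       (Seq (Loop (s + 1) (Seq (clear (s + 1)) (Seq (Ops [Inc s]) (trans f (s # as) (s + 1) (s + 2)))))
         (move s d))"
| "transs [] as e s = Ops []"
| "transs (g # gs) as e s = Seq (trans g as e s) (transs gs as (Suc e) s)"

text \<open>\<open>v d = 0\<close> turns adding to \<open>d\<close> into the update
  \<open>v(d := y)\<close> in \<open>sem_trans\<close>. As that update touches only
  \<open>d\<close>, the scratch registers are \<open>0\<close> again afterwards and can be shared by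
  successive subprograms.\<close>

definition ready :: "nat list \<Rightarrow> nat \<Rightarrow> nat \<Rightarrow> vec \<Rightarrow> bool" where
  "ready as d s v \<longleftrightarrow> (\<forall>a\<in>set as. a < s \<and> a \<noteq> d) \<and> d < s \<and> v d = 0 \<and> (\<forall>r\<ge>s. v r = 0)"

lemma rec_eval_Prim_below:
  "rec_eval (Prim f g) ((i + k) # xs) y \<Longrightarrow> \<exists>z. rec_eval (Prim f g) (i # xs) z"
  by (induction k arbitrary: y) (auto elim: rec_eval_Prim_SucE)

lemma rec_eval_Prim_Suc_iff:
  assumes "rec_eval (Prim f g) (i # xs) r"
  shows "rec_eval (Prim f g) (Suc i # xs) y \<longleftrightarrow> rec_eval g (i # r # xs) y"
  using assms rec_eval_deterministic by (blast intro: Prim_Suc elim: rec_eval_Prim_SucE)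

lemma rec_eval_Zero_iff: "rec_eval Zero xs y \<longleftrightarrow> y = 0"
  by (auto intro: rec_eval.Zero elim: rec_eval_ZeroE)

lemma rec_eval_Succ_iff: "rec_eval Succ xs y \<longleftrightarrow> (\<exists>x. xs = [x] \<and> y = Suc x)"
  by (auto intro: rec_eval.Succ elim: rec_eval_SuccE)

lemma rec_eval_Proj_iff: "rec_eval (Proj i) xs y \<longleftrightarrow> i < length xs \<and> y = xs ! i"
  by (auto intro: rec_eval.Proj elim: rec_eval_ProjE)

lemma rec_eval_Comp_iff:
  "rec_eval (Comp f gs) xs y \<longleftrightarrow>
     (\<exists>ys. list_all2 (\<lambda>g y. rec_eval g xs y) gs ys \<and> rec_eval f ys y)"
  by (auto intro: rec_eval.Comp elim: rec_eval_CompE)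

lemma rec_eval_Prim_0_iff: "rec_eval (Prim f g) (0 # xs) y \<longleftrightarrow> rec_eval f xs y"
  by (auto intro: rec_eval.Prim_0 elim: rec_eval_Prim_0E)

lemma rec_eval_Mu_iff:
  "rec_eval (Mu f) xs n \<longleftrightarrow> rec_eval f (n # xs) 0 \<and> (\<forall>m<n. \<exists>k. rec_eval f (m # xs) (Suc k))"
proof
  show "rec_eval (Mu f) xs n \<Longrightarrow>
      rec_eval f (n # xs) 0 \<and> (\<forall>m<n. \<exists>k. rec_eval f (m # xs) (Suc k))"
    by (erule rec_eval_MuE) blast
qed (rule rec_eval.Mu, simp_all)

lemma not_rec_eval_Prim_Nil: "\<not> rec_eval (Prim f g) [] y"
  by (rule notI, erule rec_eval.cases) auto

text \<open>Register \<open>s\<close> counts the remaining rounds, \<open>s + 1\<close> holds the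
  value at the recursion index in \<open>s + 2\<close>, and \<open>s + 3\<close> receives the next
  value. The last assumption is the loop invariant; the induction is on the remaining rounds. By
  \<open>rec_eval_Prim_below\<close>, a defined final value makes all intermediate values defined,
  so no round is stuck.\<close>

lemma sem_trans_Prim_loop:
  assumes g: "\<And>v v'. ready ((s + 2) # (s + 1) # as) (s + 3) (s + 4) v \<Longrightarrow> sem cg v v' \<longleftrightarrow>
      (\<exists>y. rec_eval g (map v ((s + 2) # (s + 1) # as)) y \<and> v' = v(s + 3 := y))"
    and "\<forall>a\<in>set as. a < s" "\<forall>r\<ge>s + 3. v r = 0"
    and "rec_eval (Prim f g) (v (s + 2) # map v as) (v (s + 1))"
  shows "sem (Loop s (Seq cg
          (Seq (clear (s + 1)) (Seq (move (s + 3) (s + 1)) (Ops [Inc (s + 2)]))))) v v' \<longleftrightarrow>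
    (\<exists>y. rec_eval (Prim f g) ((v (s + 2) + v s) # map v as) y \<and>
      v' = v(s := 0, s + 1 := y, s + 2 := v (s + 2) + v s))"
  using assms(2-)
proof (induction "v s" arbitrary: v)
  case 0
  then show ?case
    by (subst sem_Loop) (auto simp: fun_eq_iff dest: rec_eval_deterministic)
next
  case (Suc n)
  let ?b = "Seq cg (Seq (clear (s + 1)) (Seq (move (s + 3) (s + 1)) (Ops [Inc (s + 2)])))"
  let ?w = "\<lambda>z. v(s := n, s + 1 := z, s + 2 := Suc (v (s + 2)))"
  have map: "map (u(r := n)) as = map u as" if "r \<ge> s" for r n and u :: vec
    using Suc.prems(1) that by fastforce
  have "ready ((s + 2) # (s + 1) # as) (s + 3) (s + 4) (v(s := n))"
    using Suc.prems by (auto simp: ready_def)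
  note g = g[OF this]
  define t where "t = Seq (clear (s + 1)) (Seq (move (s + 3) (s + 1)) (Ops [Inc (s + 2)]))"
  have tail: "sem t (v(s := n, s + 3 := z)) w \<longleftrightarrow> w = ?w z" for z w
  proof -
    have "v(s := n, s + 3 := 0, s + 1 := z, s + 2 := Suc (v (s + 2))) = ?w z"
      using Suc.prems by (auto simp: fun_eq_iff)
    then show ?thesis by (simp add: t_def sem_clear sem_move fun_upd_twist)
  qed
  have n: "v s - 1 = n" using Suc.hyps(2) by simp
  have g': "rec_eval g (map (v(s := n)) ((s + 2) # (s + 1) # as)) z \<longleftrightarrow>
      rec_eval (Prim f g) (Suc (v (s + 2)) # map v as) z" for z
    using rec_eval_Prim_Suc_iff[OF Suc.prems(3)] by (simp add: map)
  have body: "sem ?b (v(s := v s - 1)) w \<longleftrightarrow>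
      (\<exists>z. rec_eval (Prim f g) (Suc (v (s + 2)) # map v as) z \<and> w = ?w z)" for w
    unfolding t_def[symmetric] sem.simps(2)[of cg] n g g' by (auto simp only: tail)
  have IH: "sem (Loop s ?b) (?w z) v' \<longleftrightarrow>
    (\<exists>y. rec_eval (Prim f g) ((v (s + 2) + v s) # map v as) y \<and>
      v' = v(s := 0, s + 1 := y, s + 2 := v (s + 2) + v s))"
    if "rec_eval (Prim f g) (Suc (v (s + 2)) # map v as) z" for z
    using Suc.hyps(1)[of "?w z"] Suc.hyps(2)[symmetric] Suc.prems that
    by (simp add: map del: sem.simps)
  have "sem (Loop s ?b) v v' \<longleftrightarrow>
      (\<exists>w. sem ?b (v(s := v s - 1)) w \<and> sem (Loop s ?b) w v')"
    using Suc.hyps(2) by (subst sem_Loop) (simp del: sem.simps)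
  also have "\<dots> \<longleftrightarrow> (\<exists>z. rec_eval (Prim f g) (Suc (v (s + 2)) # map v as) z \<and>
      sem (Loop s ?b) (?w z) v')"
    unfolding body by blast
  finally show ?case
    using IH Suc.hyps(2)[symmetric] rec_eval_Prim_below[of f g "Suc (v (s + 2))" n "map v as"]
    by (auto simp del: sem.simps)
qed

text \<open>Register \<open>s\<close> holds the candidate and \<open>s + 1\<close> the value of
  \<open>f\<close> there. The number of rounds is not known in advance, so the directions are
  separate: one carries an invariant along the closure, the other is an induction on the distance
  \<open>y - v s\<close> to the minimum.\<close>

lemma sem_trans_Mu_loop:
  assumes cf: "\<And>v v'. ready (s # as) (s + 1) (s + 2) v \<Longrightarrow> sem cf v v' \<longleftrightarrow>
      (\<exists>y. rec_eval f (map v (s # as)) y \<and> v' = v(s + 1 := y))"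
    and as: "\<forall>a\<in>set as. a < s" and "\<forall>r\<ge>s + 2. v r = 0"
    and "\<forall>m<v s. \<exists>k. rec_eval f (m # map v as) (Suc k)"
    and "rec_eval f (map v (s # as)) (v (s + 1))"
  shows "sem (Loop (s + 1) (Seq (clear (s + 1)) (Seq (Ops [Inc s]) cf))) v v' \<longleftrightarrow>
    (\<exists>y. rec_eval (Mu f) (map v as) y \<and> v' = v(s := y, s + 1 := 0))"
    (is "sem (Loop _ ?b) v v' \<longleftrightarrow> _")
proof -
  have map: "map (v(r := n)) as = map v as" if "r \<ge> s" for r n and v :: vec
    using as that by fastforce
  have body: "sem ?b (v(s + 1 := n)) w \<longleftrightarrow>
      (\<exists>z. rec_eval f (Suc (v s) # map v as) z \<and> w = v(s := Suc (v s), s + 1 := z))"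
    if "\<forall>r\<ge>s + 2. v r = 0" for v n w
  proof -
    have "ready (s # as) (s + 1) (s + 2) (v(s + 1 := 0, s := Suc (v s)))"
      using that as by (auto simp: ready_def)
    then show ?thesis
      by (auto simp: cf sem_clear map fun_upd_twist)
  qed
  define I where "I v \<longleftrightarrow> (\<forall>r\<ge>s + 2. v r = 0) \<and> rec_eval f (map v (s # as)) (v (s + 1)) \<and>
    (\<forall>m<v s. \<exists>k. rec_eval f (m # map v as) (Suc k))" for v
  have "I v" using assms(3-) by (simp add: I_def)
  let ?R = "\<lambda>v v'. 0 < v (s + 1) \<and> sem ?b (v(s + 1 := v (s + 1) - 1)) v'"
  have I_step: "I w \<and> map w as = map v as \<and> (\<exists>y z. w = v(s := y, s + 1 := z))"
    if I: "I v" and R: "?R v w" for v w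
  proof -
    obtain z where z: "rec_eval f (Suc (v s) # map v as) z" "w = v(s := Suc (v s), s + 1 := z)"
      using I R body[of v "v (s + 1) - 1" w] unfolding I_def by blast
    have "\<exists>k. rec_eval f (v s # map v as) (Suc k)"
      using I R by (auto simp: I_def gr0_conv_Suc)
    then show ?thesis
      using z I by (auto simp: I_def map less_Suc_eq)
  qed
  show ?thesis
  proof
    assume "sem (Loop (s + 1) ?b) v v'"
    then have "?R\<^sup>*\<^sup>* v v'" and 0: "v' (s + 1) = 0" by (simp_all add: sem.simps(3))
    from this(1) \<open>I v\<close>
    have "I v' \<and> map v' as = map v as \<and> (\<exists>y z. v' = v(s := y, s + 1 := z))"
    proof (induction rule: converse_rtranclp_induct)
      case base
      have "v' = v'(s := v' s, s + 1 := v' (s + 1))" by simp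
      then have "\<exists>y z. v' = v'(s := y, s + 1 := z)" by (intro exI)
      then show ?case by (intro conjI refl base)
    next
      case (step x w)
      note w = I_step[OF step.prems step.hyps(1)]
      then obtain y z where "w = x(s := y, s + 1 := z)" by blast
      moreover from w step.IH obtain y' z' where "v' = w(s := y', s + 1 := z')" by blast
      ultimately have "v' = x(s := y', s + 1 := z')" by (simp add: fun_upd_twist)
      moreover from w step.IH have "I v'" "map v' as = map x as" by simp_all
      ultimately show ?case by blast
    qed
    with 0 show "\<exists>y. rec_eval (Mu f) (map v as) y \<and> v' = v(s := y, s + 1 := 0)"
      by (auto simp: rec_eval_Mu_iff I_def map)
  next
    assume "\<exists>y. rec_eval (Mu f) (map v as) y \<and> v' = v(s := y, s + 1 := 0)"
    then obtain y where y: "rec_eval (Mu f) (map v as) y" "v' = v(s := y, s + 1 := 0)"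
      by blast
    \<comment> \<open>A larger candidate would have passed \<open>y\<close>, where the invariant
      \<open>I\<close> gives a nonzero value of \<open>f\<close> although \<open>y\<close> is a
      zero.\<close>
    have "v s \<le> y"
    proof (rule ccontr)
      assume "\<not> v s \<le> y"
      then obtain k where "rec_eval f (y # map v as) (Suc k)"
        using \<open>I v\<close> unfolding I_def by (meson not_le)
      with y(1) show False by (auto simp: rec_eval_Mu_iff dest: rec_eval_deterministic)
    qed
    with \<open>I v\<close> y show "sem (Loop (s + 1) ?b) v v'"
    proof (induction "y - v s" arbitrary: v)
      case 0
      then have "v s = y" by simp
      with 0 have "v (s + 1) = 0"
        by (auto simp: rec_eval_Mu_iff I_def dest: rec_eval_deterministic)
      with 0 \<open>v s = y\<close> show ?case by (subst sem_Loop) (auto simp: fun_eq_iff)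
    next
      case (Suc n)
      then have "v s < y" by simp
      with Suc.prems obtain k where "rec_eval f (v s # map v as) (Suc k)"
        by (auto simp: rec_eval_Mu_iff)
      with Suc.prems have pos: "v (s + 1) > 0"
        by (auto simp: I_def dest: rec_eval_deterministic)
      obtain z where z: "rec_eval f (Suc (v s) # map v as) z"
        using \<open>v s < y\<close> Suc.prems(2) unfolding rec_eval_Mu_iff by (metis Suc_lessI)
      define w where "w = v(s := Suc (v s), s + 1 := z)"
      have R: "?R v w"
        using z pos body[of v] Suc.prems by (auto simp: w_def I_def)
      have Iw: "I w" "map w as = map v as"
        using I_step[OF \<open>I v\<close> R] by auto
      have "sem (Loop (s + 1) ?b) w v'"
      proof (rule Suc.hyps(1))
        show "n = y - w s" "w s \<le> y" using Suc.hyps(2) \<open>v s < y\<close> by (auto simp: w_def)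
        show "v' = w(s := y, s + 1 := 0)" using Suc.prems by (auto simp: w_def fun_eq_iff)
      qed (use Iw Suc.prems in \<open>simp_all only:\<close>)
      with R show ?case by (subst sem_Loop) auto
    qed
  qed
qed

text \<open>Being an equivalence, this also says that the program has no complete run where the
  function is undefined. Both parts are proved together because \<open>Comp\<close> passes through
  \<open>transs\<close>.\<close>

lemma sem_trans:
  "ready as d s v \<Longrightarrow>
    sem (trans f as d s) v v' \<longleftrightarrow> (\<exists>y. rec_eval f (map v as) y \<and> v' = v(d := y))"
  "\<forall>a\<in>set as. a < e \<Longrightarrow> e + length gs \<le> s \<Longrightarrow> \<forall>r\<ge>e. v r = 0 \<Longrightarrow>
    sem (transs gs as e s) v v' \<longleftrightarrow>
      (\<exists>ys. list_all2 (\<lambda>g y. rec_eval g (map v as) y) gs ys \<and>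
        v' = (\<lambda>r. if e \<le> r \<and> r < e + length gs then ys ! (r - e) else v r))"
proof (induction f as d s and gs as e s arbitrary: v v' and v v' rule: trans_transs.induct)
  case (1 as d s)
  then show ?case by (auto simp: ready_def rec_eval_Zero_iff fun_upd_idem)
next
  case (2 as d s)
  then show ?case
    by (cases as) (auto simp: ready_def sem_copy rec_eval_Succ_iff)
next
  case (3 i as d s)
  then have "i < length as \<Longrightarrow> sem (copy (as ! i) d s) v v' \<longleftrightarrow> v' = v(d := v (as ! i))"
    by (subst sem_copy) (auto simp: ready_def)
  with 3 show ?case
    by (auto simp: ready_def rec_eval_Proj_iff)
next
  case (4 f gs as d s)
  let ?m = "length gs"
  let ?w = "\<lambda>ys r. if s \<le> r \<and> r < s + ?m then ys ! (r - s) else v r"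
  have 1: "sem (transs gs as s (s + ?m)) v w \<longleftrightarrow>
      (\<exists>ys. list_all2 (\<lambda>g y. rec_eval g (map v as) y) gs ys \<and> w = ?w ys)" for w
    using 4 by (auto simp: ready_def)
  have 2: "sem (Seq (trans f [s..<s + ?m] d (s + ?m)) (clears s ?m)) (?w ys) v' \<longleftrightarrow>
      (\<exists>y. rec_eval f ys y \<and> v' = v(d := y))" if "length ys = ?m" for ys
  proof -
    have map: "map (?w ys) [s..<s + ?m] = ys" using that by (auto intro: nth_equalityI)
    have "ready [s..<s + ?m] d (s + ?m) (?w ys)"
      using 4(3) by (auto simp: ready_def)
    note IH = 4(2)[OF this, unfolded map]
    have "(\<lambda>r. if s \<le> r \<and> r < s + ?m then 0 else ((?w ys)(d := y)) r) = v(d := y)" for y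
      using 4(3) by (auto simp: ready_def)
    then show ?thesis
      unfolding sem_Seq_ex[OF IH] sem_clears by simp
  qed
  show ?case
    unfolding trans.simps rec_eval_Comp_iff sem_Seq_ex[OF 1]
    using 2 list_all2_lengthD by (smt (verit, best))
next
  case (5 f g as d s)
  show ?case
  proof (cases as)
    case Nil
    then show ?thesis using 5 by (auto simp: ready_def not_rec_eval_Prim_Nil)
  next
    case (Cons a as')
    have map: "map (v(r := n)) as' = map v as'" if "r \<ge> s" for r n and v :: vec
      using that 5(3) Cons by (fastforce simp: ready_def)
    let ?c = "Seq (trans g ((s + 2) # (s + 1) # as') (s + 3) (s + 4))
                (Seq (clear (s + 1)) (Seq (move (s + 3) (s + 1)) (Ops [Inc (s + 2)])))"
    have 1: "sem (copy a s (s + 1)) v w \<longleftrightarrow> w = v(s := v a)" for w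
      using 5(3) Cons by (subst sem_copy) (auto simp: ready_def)
    have "ready as' (s + 1) (s + 2) (v(s := v a))"
      using 5(3) Cons by (auto simp: ready_def)
    from 5(1)[OF Cons this] have 2: "sem (trans f as' (s + 1) (s + 2)) (v(s := v a)) w \<longleftrightarrow>
        (\<exists>r. rec_eval f (map v as') r \<and> w = v(s := v a, s + 1 := r))" for w
      by (simp only: map order_refl)
    have 3: "sem (Loop s ?c) (v(s := v a, s + 1 := r)) w \<longleftrightarrow>
        (\<exists>y. rec_eval (Prim f g) (map v as) y \<and> w = v(s + 1 := y, s + 2 := v a))"
      if "rec_eval f (map v as') r" for r w
    proof -
      let ?v = "v(s := v a, s + 1 := r)"
      have v: "\<forall>a\<in>set as'. a < s" "\<forall>r\<ge>s + 3. ?v r = 0"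
        using 5(3) Cons by (auto simp: ready_def)
      have "?v (s + 2) = 0" "?v (s + 1) = r" "?v s = v a"
        and upd: "?v(s := 0, s + 1 := y, s + 2 := v a) = v(s + 1 := y, s + 2 := v a)" for y
        using 5(3) by (auto simp: ready_def fun_eq_iff)
      moreover have "map ?v as' = map v as'" by (simp add: map)
      ultimately show ?thesis
        using sem_trans_Prim_loop[OF 5(2)[OF Cons] v, of f w] that
        by (simp only: rec_eval_Prim_0_iff add_0 upd Cons list.map)
    qed
    have 4: "\<exists>r. rec_eval f (map v as') r" if "rec_eval (Prim f g) (map v as) y" for y
      using rec_eval_Prim_below[of f g 0 "v a" "map v as'"] that Cons
      by (simp add: rec_eval_Prim_0_iff)
    have 5: "sem (Seq (move (s + 1) d) (clear (s + 2))) (v(s + 1 := y, s + 2 := v a)) v' \<longleftrightarrow>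
        v' = v(d := y)" for y
    proof -
      have "v(s + 1 := y, s + 2 := v a, s + 1 := 0, d := y, s + 2 := 0) = v(d := y)"
        using 5(3) by (auto simp: ready_def fun_eq_iff)
      then show ?thesis
        using 5(3) by (simp add: sem_move sem_clear ready_def)
    qed
    have "sem (Seq (Loop s ?c) (Seq (move (s + 1) d) (clear (s + 2)))) (v(s := v a, s + 1 := r)) v' \<longleftrightarrow>
        (\<exists>y. rec_eval (Prim f g) (map v as) y \<and> v' = v(d := y))"
      if "rec_eval f (map v as') r" for r
      unfolding sem_Seq_ex[OF 3[OF that]] 5 ..
    then show ?thesis
      unfolding Cons trans.simps list.case sem_Seq_det[OF 1] sem_Seq_ex[OF 2]
      using 4 unfolding Cons by blast
  qed
next
  case (6 f as d s)
  have map: "map (u(r := n)) as = map u as" if "r \<ge> s" for r n and u :: vec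
    using that 6(3) by (fastforce simp: ready_def)
  have v: "v s = 0" "v(s := 0) = v" "\<forall>a\<in>set as. a < s"
    using 6(3) by (auto simp: ready_def)
  let ?c = "Seq (clear (s + 1)) (Seq (Ops [Inc s]) (trans f (s # as) (s + 1) (s + 2)))"
  have "ready (s # as) (s + 1) (s + 2) v"
    using 6(3) by (auto simp: ready_def)
  from 6(1)[OF this] have 1: "sem (trans f (s # as) (s + 1) (s + 2)) v w \<longleftrightarrow>
      (\<exists>r. rec_eval f (0 # map v as) r \<and> w = v(s + 1 := r))" for w
    by (simp only: list.map v(1))
  have 2: "sem (Loop (s + 1) ?c) (v(s + 1 := r)) w \<longleftrightarrow>
      (\<exists>y. rec_eval (Mu f) (map v as) y \<and> w = v(s := y, s + 1 := 0))"
    if "rec_eval f (0 # map v as) r" for r w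
  proof -
    let ?v = "v(s + 1 := r)"
    have v': "\<forall>r\<ge>s + 2. ?v r = 0" "?v s = 0" "?v (s + 1) = r"
      and upd: "?v(s := y, s + 1 := 0) = v(s := y, s + 1 := 0)" for y
      using 6(3) by (auto simp: ready_def fun_eq_iff)
    moreover have "map ?v as = map v as" by (simp add: map)
    ultimately show ?thesis
      using sem_trans_Mu_loop[OF 6(1) v(3) v'(1), of w] that
      by (simp only: list.map upd not_less_zero simp_thms)
  qed
  \<comment> \<open>The program evaluates \<open>f\<close> at \<open>0\<close> before it enters the
    loop; a defined minimum guarantees that this first evaluation succeeds.\<close>
  have 3: "\<exists>r. rec_eval f (0 # map v as) r" if "rec_eval (Mu f) (map v as) y" for y
    using that unfolding rec_eval_Mu_iff by (cases y) auto
  have 4: "sem (move s d) (v(s := y, s + 1 := 0)) v' \<longleftrightarrow> v' = v(d := y)" for y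
  proof -
    have "v(s := y, s + 1 := 0, s := 0, d := y) = v(d := y)"
      using 6(3) by (auto simp: ready_def fun_eq_iff)
    then show ?thesis
      using 6(3) by (simp add: sem_move ready_def)
  qed
  have "sem (Seq (Loop (s + 1) ?c) (move s d)) (v(s + 1 := r)) v' \<longleftrightarrow>
      (\<exists>y. rec_eval (Mu f) (map v as) y \<and> v' = v(d := y))"
    if "rec_eval f (0 # map v as) r" for r
    unfolding sem_Seq_ex[OF 2[OF that]] 4 ..
  then show ?case
    unfolding trans.simps sem_Seq_ex[OF 1] using 3 by blast
next
  case (7 as e s)
  then show ?case by (simp add: not_less[symmetric] cong: if_cong)
next
  case (8 g gs as e s)
  have "ready as e s v"
    using 8(3-) by (auto simp: ready_def)
  note 1 = 8(1)[OF this]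
  have map: "map (v(e := y)) as = map v as" for y
    using 8(3) by auto
  have 2: "sem (transs gs as (Suc e) s) (v(e := y)) v' \<longleftrightarrow>
    (\<exists>ys. list_all2 (\<lambda>g y. rec_eval g (map v as) y) gs ys \<and>
        v' = (\<lambda>r. if e \<le> r \<and> r < e + length (g # gs) then (y # ys) ! (r - e) else v r))" for y
  proof -
    have "(\<lambda>r. if Suc e \<le> r \<and> r < Suc e + length gs then ys ! (r - Suc e) else (v(e := y)) r) =
        (\<lambda>r. if e \<le> r \<and> r < e + length (g # gs) then (y # ys) ! (r - e) else v r)" for ys
      by (auto simp: fun_eq_iff nth_Cons')
    moreover have "\<forall>a\<in>set as. a < Suc e" "Suc e + length gs \<le> s" "\<forall>r\<ge>Suc e. (v(e := y)) r = 0"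
      using 8(3-) by auto
    ultimately show ?thesis
      using 8(2)[of "v(e := y)" v'] by (simp only: map)
  qed
  show ?case
    unfolding transs.simps sem_Seq_ex[OF 1] 2 list_all2_Cons1 by blast
qed

section \<open>Counter machines with nondeterministic control\<close>

fun fresh_states :: "com \<Rightarrow> nat" where
  "fresh_states (Ops xs) = 0"
| "fresh_states (Seq c d) = Suc (fresh_states c + fresh_states d)"
| "fresh_states (Loop r c) = Suc (fresh_states c)"

text \<open>Entry \<open>i\<close>, exit \<open>j\<close>, internal states numbered from
  \<open>n\<close> on. The test of a loop takes place at its entry, so the body is a graph from
  \<open>n\<close> back to \<open>i\<close>.\<close>

fun graph :: "com \<Rightarrow> nat \<Rightarrow> nat \<Rightarrow> nat \<Rightarrow> (nat \<times> op list \<times> nat) list" where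
  "graph (Ops xs) i j n = [(i, xs, j)]"
| "graph (Seq c d) i j n = graph c i n (Suc n) @ graph d n j (Suc n + fresh_states c)"
| "graph (Loop r c) i j n = (i, [Tst r], j) # (i, [Dec r], n) # graph c n i (Suc n)"

definition gstep :: "(nat \<times> op list \<times> nat) set \<Rightarrow> nat \<times> vec \<Rightarrow> nat \<times> vec \<Rightarrow> bool" where
  "gstep E s t \<longleftrightarrow> (\<exists>xs. (fst s, xs, fst t) \<in> E \<and> ops_sem xs (snd s) (snd t))"

text \<open>Since internal ranges of subgraphs are disjoint, the source of an edge reveals the
  subgraph it belongs to.\<close>

lemma graph_source: "(a, xs, b) \<in> set (graph c i j n) \<Longrightarrow> a = i \<or> n \<le> a \<and> a < n + fresh_states c"
  by (induction c i j n rule: graph.induct) fastforce+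

lemma graph_complete:
  "set (graph c i j n) \<subseteq> E \<Longrightarrow> sem c v v' \<Longrightarrow> (gstep E)\<^sup>*\<^sup>* (i, v) (j, v')"
proof (induction c i j n arbitrary: v v' rule: graph.induct)
  case (1 xs i j n)
  then have "gstep E (i, v) (j, v')" by (auto simp: gstep_def)
  then show ?case ..
next
  case (2 c d i j n)
  then obtain w where "sem c v w" "sem d w v'" by auto
  with 2 have "(gstep E)\<^sup>*\<^sup>* (i, v) (n, w)" "(gstep E)\<^sup>*\<^sup>* (n, w) (j, v')" by simp_all
  then show ?case by (rule rtranclp_trans)
next
  case (3 r c i j n)
  have "(\<lambda>v v'. 0 < v r \<and> sem c (v(r := v r - 1)) v')\<^sup>*\<^sup>* v v'" and 0: "v' r = 0"
    using 3(3) by (simp_all add: sem.simps(3))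
  from this(1) have "(gstep E)\<^sup>*\<^sup>* (i, v) (i, v')"
  proof (induction rule: rtranclp_induct)
    case (step y z)
    have "gstep E (i, y) (n, y(r := y r - 1))"
      using step.hyps(2) 3(2) by (auto simp: gstep_def intro!: exI[of _ "[Dec r]"])
    moreover have "(gstep E)\<^sup>*\<^sup>* (n, y(r := y r - 1)) (i, z)"
      using conjunct2[OF step.hyps(2)] 3(2) by (intro 3(1)) (auto simp del: fun_upd_apply)
    ultimately show ?case using step.IH by (meson converse_rtranclp_into_rtranclp rtranclp_trans)
  qed simp
  moreover have "gstep E (i, v') (j, v')"
    using 0 3(2) by (auto simp: gstep_def intro!: exI[of _ "[Tst r]"])
  ultimately show ?case by (rule rtranclp.rtrancl_into_rtrancl)
qed

text \<open>A run to a state that is neither \<open>i\<close> nor internal has to leave through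
  \<open>j\<close>, after a complete execution of \<open>c\<close>: by the second assumption no
  other edge of \<open>E\<close> leads out. The strict bound \<open>l < k\<close> serves the loop
  case, where control returns to \<open>i\<close> and the induction is on the length of the
  run.\<close>

lemma graph_sound:
  assumes "(gstep E ^^ k) (i, v) (q, u)"
    and "\<And>a xs b. (a, xs, b) \<in> E \<Longrightarrow> a = i \<or> n \<le> a \<and> a < n + fresh_states c \<Longrightarrow>
      (a, xs, b) \<in> set (graph c i j n)"
    and "i < n" "q \<noteq> i" "q < n"
  shows "\<exists>v' l. l < k \<and> sem c v v' \<and> (gstep E ^^ l) (j, v') (q, u)"
  using assms
proof (induction c i j n arbitrary: k v rule: graph.induct)
  case (1 xs i j n)
  then obtain l where k: "k = Suc l" by (cases k) auto
  with 1(1) obtain s where s: "gstep E (i, v) s" "(gstep E ^^ l) s (q, u)"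
    using relpowp_Suc_D2 by metis
  then obtain ys where "(i, ys, fst s) \<in> E" "ops_sem ys v (snd s)" by (auto simp: gstep_def)
  with 1(2)[of i ys "fst s"] have "fst s = j" "sem (Ops xs) v (snd s)" by auto
  with s(2) k show ?case by (metis lessI prod.collapse)
next
  case (2 c d i j n)
  have "\<exists>v' l. l < k \<and> sem c v v' \<and> (gstep E ^^ l) (n, v') (q, u)"
  proof (rule 2(1)[OF 2(3)])
    fix a xs b assume "(a, xs, b) \<in> E" and a: "a = i \<or> Suc n \<le> a \<and> a < Suc n + fresh_states c"
    with 2(4)[of a xs b] have "(a, xs, b) \<in> set (graph (Seq c d) i j n)" by auto
    with a 2(5) graph_source[of a xs b d] show "(a, xs, b) \<in> set (graph c i n (Suc n))"
      by fastforce
  qed (use 2 in auto)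
  then obtain w l where l: "l < k" "sem c v w" "(gstep E ^^ l) (n, w) (q, u)" by blast
  have "\<exists>v' l'. l' < l \<and> sem d w v' \<and> (gstep E ^^ l') (j, v') (q, u)"
  proof (rule 2(2)[OF l(3)])
    fix a xs b assume "(a, xs, b) \<in> E"
      and a: "a = n \<or> Suc n + fresh_states c \<le> a \<and> a < Suc n + fresh_states c + fresh_states d"
    with 2(4)[of a xs b] have "(a, xs, b) \<in> set (graph (Seq c d) i j n)" by auto
    with a 2(5) graph_source[of a xs b c]
    show "(a, xs, b) \<in> set (graph d n j (Suc n + fresh_states c))"
      by fastforce
  qed (use 2 in auto)
  with l show ?case by (metis less_trans sem.simps(2))
next
  case (3 r c i j n)
  show ?case using 3(2)
  proof (induction k arbitrary: v rule: less_induct)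
    case (less k)
    then obtain l where k: "k = Suc l" using 3(5) by (cases k) auto
    with less.prems obtain s where s: "gstep E (i, v) s" "(gstep E ^^ l) s (q, u)"
      using relpowp_Suc_D2 by metis
    then obtain ys where ys: "(i, ys, fst s) \<in> E" "ops_sem ys v (snd s)" by (auto simp: gstep_def)
    with 3(3)[of i ys "fst s"] have "(i, ys, fst s) \<in> set (graph (Loop r c) i j n)" by simp
    with 3(4) graph_source[of i ys "fst s" c n i "Suc n"]
    consider "ys = [Tst r]" "fst s = j" | "ys = [Dec r]" "fst s = n" by auto
    then show ?case
    proof cases
      case 1
      with ys have "v r = 0" "s = (j, v)" by (auto intro: prod_eqI)
      moreover from \<open>v r = 0\<close> have "sem (Loop r c) v v" by (subst sem_Loop) simp
      ultimately show ?thesis using s(2) k by blast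
    next
      case 2
      with ys have v: "0 < v r" "s = (n, v(r := v r - 1))" by (auto intro: prod_eqI)
      have "\<exists>v' l'. l' < l \<and> sem c (v(r := v r - 1)) v' \<and> (gstep E ^^ l') (i, v') (q, u)"
      proof (rule 3(1))
        show "(gstep E ^^ l) (n, v(r := v r - 1)) (q, u)" using s(2) v by simp
        fix a xs b assume "(a, xs, b) \<in> E" and a: "a = n \<or> Suc n \<le> a \<and> a < Suc n + fresh_states c"
        with 3(3)[of a xs b] have "(a, xs, b) \<in> set (graph (Loop r c) i j n)" by auto
        with a 3(4) show "(a, xs, b) \<in> set (graph c n i (Suc n))" by auto
      qed (use 3 in auto)
      then obtain w l' where w: "l' < l" "sem c (v(r := v r - 1)) w"
        "(gstep E ^^ l') (i, w) (q, u)" by blast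
      with less.IH[of l' w] k obtain v' m where "m < l'" "sem (Loop r c) w v'"
        "(gstep E ^^ m) (j, v') (q, u)" by auto
      moreover have "sem (Loop r c) v v'"
        using v w calculation by (subst sem_Loop) auto
      ultimately show ?thesis using w k by (metis less_SucI less_trans)
    qed
  qed
qed

section \<open>Removing the control state\<close>

definition vstep :: "op list set \<Rightarrow> vec \<Rightarrow> vec \<Rightarrow> bool" where
  "vstep P v v' \<longleftrightarrow> (\<exists>b\<in>P. ops_sem b v v')"

text \<open>Acceptance is tied to the last block because the rewriting system will recognise it by
  \<open>Ptr\<close> standing at the end of the word, that is, by completion of the last block of
  the program text.\<close>

definition accepts :: "op list list \<Rightarrow> vec \<Rightarrow> bool" where
  "accepts bs v \<longleftrightarrow> (\<exists>w w'. (vstep (set bs))\<^sup>*\<^sup>* v w \<and> ops_sem (last bs) w w')"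

fun double :: "op \<Rightarrow> op" where
  "double (Inc r) = Inc (2 * r)"
| "double (Dec r) = Dec (2 * r)"
| "double (Tst r) = Tst (2 * r)"

text \<open>The control state is stored in one-hot form in the odd registers.\<close>

fun edge_ops :: "nat \<times> op list \<times> nat \<Rightarrow> op list" where
  "edge_ops (i, xs, j) = Dec (2 * i + 1) # map double xs @ [Inc (2 * j + 1)]"

definition interleave :: "vec \<Rightarrow> vec \<Rightarrow> vec" where
  "interleave v u = (\<lambda>n. if even n then v (n div 2) else u (n div 2))"

definition state_vec :: "nat \<times> vec \<Rightarrow> vec" where
  "state_vec s = interleave (snd s) ((\<lambda>_. 0)(fst s := 1))"

lemma ops_sem_append: "ops_sem (xs @ ys) v v' \<longleftrightarrow> (\<exists>w. ops_sem xs v w \<and> ops_sem ys w v')"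
  by (induction xs arbitrary: v) auto

lemma interleave_upd:
  "(interleave v u)(2 * r := x) = interleave (v(r := x)) u"
  "(interleave v u)(2 * r + 1 := x) = interleave v (u(r := x))"
  by (auto simp: interleave_def fun_eq_iff)

lemma interleave_apply: "interleave v u (2 * r) = v r" "interleave v u (2 * r + 1) = u r"
  by (simp_all add: interleave_def)

lemma ex_ex_eq_conj: "(\<exists>w. (\<exists>y. P y \<and> w = f y) \<and> Q w) \<longleftrightarrow> (\<exists>y. P y \<and> Q (f y))"
  by blast

lemma ops_sem_double:
  "ops_sem (map double xs) (interleave v u) w \<longleftrightarrow> (\<exists>v'. ops_sem xs v v' \<and> w = interleave v' u)"
proof (induction xs arbitrary: v)
  case (Cons x xs)
  have x: "op_sem (double x) (interleave v u) w \<longleftrightarrow> (\<exists>v'. op_sem x v v' \<and> w = interleave v' u)" for w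
    by (cases x) (auto simp: interleave_upd interleave_apply)
  then show ?case
    unfolding list.map ops_sem.simps x ex_ex_eq_conj Cons.IH by blast
qed simp

text \<open>The leading \<open>Dec\<close> succeeds only if the flag of the source state is set, so
  a wrongly guessed block is stuck at once; the final \<open>Inc\<close> restores the one-hot
  form.\<close>

lemma ops_sem_edge:
  "ops_sem (edge_ops e) (state_vec s) u \<longleftrightarrow>
     (\<exists>t. fst e = fst s \<and> fst t = snd (snd e) \<and> ops_sem (fst (snd e)) (snd s) (snd t) \<and> u = state_vec t)"
proof -
  obtain i xs j k v where e: "e = (i, xs, j)" and s: "s = (k, v)"
    by (metis prod.collapse)
  have state: "state_vec (k, v) = interleave v ((\<lambda>_. 0)(k := 1))" for k v
    by (simp add: state_vec_def)
  have "ops_sem (edge_ops e) (state_vec s) u \<longleftrightarrow>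
      k = i \<and> (\<exists>v'. ops_sem xs v v' \<and> u = state_vec (j, v'))"
  proof -
    have dec: "op_sem (Dec (2 * i + 1)) (state_vec s) w \<longleftrightarrow> k = i \<and> w = interleave v (\<lambda>_. 0)" for w
      unfolding s state op_sem.simps interleave_apply interleave_upd by (auto simp: fun_upd_idem)
    have inc: "ops_sem [Inc (2 * j + 1)] (interleave v' (\<lambda>_. 0)) w \<longleftrightarrow> w = state_vec (j, v')" for v' w
      unfolding state by (simp add: interleave_apply interleave_upd flip: One_nat_def)
    have "(\<exists>w. ops_sem (map double xs) (interleave v (\<lambda>_. 0)) w \<and> ops_sem [Inc (2 * j + 1)] w u) \<longleftrightarrow>
        (\<exists>v'. ops_sem xs v v' \<and> u = state_vec (j, v'))"
      unfolding ops_sem_double ex_ex_eq_conj inc ..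
    then show ?thesis
      unfolding e edge_ops.simps ops_sem.simps(2)[of "Dec _"] dec ops_sem_append by blast
  qed
  then show ?thesis by (auto simp: e s)
qed

lemma vstep_edges:
  "vstep (edge_ops ` E) (state_vec s) u \<longleftrightarrow> (\<exists>t. gstep E s t \<and> u = state_vec t)"
proof
  assume "vstep (edge_ops ` E) (state_vec s) u"
  then obtain e where "e \<in> E" "ops_sem (edge_ops e) (state_vec s) u"
    unfolding vstep_def by blast
  then show "\<exists>t. gstep E s t \<and> u = state_vec t"
    unfolding ops_sem_edge gstep_def by (metis prod.collapse)
next
  assume "\<exists>t. gstep E s t \<and> u = state_vec t"
  then obtain t xs where t: "u = state_vec t" "(fst s, xs, fst t) \<in> E"
    "ops_sem xs (snd s) (snd t)"
    unfolding gstep_def by blast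
  then have "ops_sem (edge_ops (fst s, xs, fst t)) (state_vec s) u"
    unfolding ops_sem_edge by auto
  with t(2) show "vstep (edge_ops ` E) (state_vec s) u"
    unfolding vstep_def by blast
qed

lemma vsteps_edges:
  "(vstep (edge_ops ` E))\<^sup>*\<^sup>* (state_vec s) u \<longleftrightarrow> (\<exists>t. (gstep E)\<^sup>*\<^sup>* s t \<and> u = state_vec t)"
proof
  assume "(vstep (edge_ops ` E))\<^sup>*\<^sup>* (state_vec s) u"
  then show "\<exists>t. (gstep E)\<^sup>*\<^sup>* s t \<and> u = state_vec t"
  proof (induction rule: rtranclp_induct)
    case (step y z)
    then show ?case by (metis rtranclp.rtrancl_into_rtrancl vstep_edges)
  qed blast
next
  assume "\<exists>t. (gstep E)\<^sup>*\<^sup>* s t \<and> u = state_vec t"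
  then obtain t where "(gstep E)\<^sup>*\<^sup>* s t" and u: "u = state_vec t" by blast
  from this(1) show "(vstep (edge_ops ` E))\<^sup>*\<^sup>* (state_vec s) u"
    unfolding u
  proof (induction rule: rtranclp_induct)
    case (step y z)
    then show ?case by (metis rtranclp.rtrancl_into_rtrancl vstep_edges)
  qed auto
qed

text \<open>After interleaving, register \<open>0\<close> is data register \<open>0\<close>, the
  argument, and register \<open>1\<close> is the flag of the entry state \<open>0\<close>.\<close>

definition init_vec :: "nat \<Rightarrow> vec" where
  "init_vec x = (\<lambda>_. 0)(0 := x, 1 := 1)"

text \<open>The loop at the exit state \<open>1\<close> signals acceptance.\<close>

definition recf_blocks :: "recf \<Rightarrow> op list list" where
  "recf_blocks p = map edge_ops (graph (trans p [0] 1 2) 0 1 2 @ [(1, [], 1)])"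

lemma accepts_recf_blocks:
  "accepts (recf_blocks p) (init_vec x) \<longleftrightarrow> (\<exists>y. rec_eval p [x] y)"
proof -
  define c where "c = trans p [0] 1 2"
  define E where "E = set (graph c 0 1 2 @ [(1, [], 1)])"
  define v :: vec where "v = (\<lambda>_. 0)(0 := x)"
  have init: "init_vec x = state_vec (0, v)"
    by (auto simp: init_vec_def state_vec_def interleave_def v_def fun_eq_iff)
  have blocks: "set (recf_blocks p) = edge_ops ` E" "last (recf_blocks p) = edge_ops (1, [], 1)"
    by (auto simp: recf_blocks_def E_def c_def)
  have "accepts (recf_blocks p) (init_vec x) \<longleftrightarrow> (\<exists>w. (gstep E)\<^sup>*\<^sup>* (0, v) (1, w))"
  proof
    assume "accepts (recf_blocks p) (init_vec x)"
    then obtain s u where s: "(gstep E)\<^sup>*\<^sup>* (0, v) s" "ops_sem (edge_ops (1, [], 1)) (state_vec s) u"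
      unfolding accepts_def blocks init vsteps_edges by blast
    then have "fst s = 1" unfolding ops_sem_edge by simp
    with s(1) have "(gstep E)\<^sup>*\<^sup>* (0, v) (1, snd s)" by (metis prod.collapse)
    then show "\<exists>w. (gstep E)\<^sup>*\<^sup>* (0, v) (1, w)" by blast
  next
    assume "\<exists>w. (gstep E)\<^sup>*\<^sup>* (0, v) (1, w)"
    then obtain w where w: "(gstep E)\<^sup>*\<^sup>* (0, v) (1, w)" by blast
    have "ops_sem (edge_ops (1, [], 1)) (state_vec (1, w)) (state_vec (1, w))"
      unfolding ops_sem_edge by (intro exI[of _ "(1, w)"]) simp
    with w show "accepts (recf_blocks p) (init_vec x)"
      unfolding accepts_def blocks init vsteps_edges by blast
  qed
  also have "\<dots> \<longleftrightarrow> (\<exists>w. sem c v w)"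
  proof
    assume "\<exists>w. (gstep E)\<^sup>*\<^sup>* (0, v) (1, w)"
    then obtain w k where "(gstep E ^^ k) (0, v) (1, w)" by (auto simp: rtranclp_power)
    then have "\<exists>v' l. l < k \<and> sem c v v' \<and> (gstep E ^^ l) (1, v') (1, w)"
      by (rule graph_sound[where n = 2]) (auto simp: E_def)
    then show "\<exists>w. sem c v w" by blast
  next
    assume "\<exists>w. sem c v w"
    then show "\<exists>w. (gstep E)\<^sup>*\<^sup>* (0, v) (1, w)"
      using graph_complete[of c 0 1 2 E v] by (auto simp: E_def)
  qed
  also have "\<dots> \<longleftrightarrow> (\<exists>y. rec_eval p [x] y)"
    using sem_trans(1)[of "[0]" 1 2 v p] by (auto simp: c_def ready_def v_def)
  finally show ?thesis .
qed

section \<open>Rewriting systems as correspondence problems\<close>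

type_synonym site_rule = "(nat list \<times> nat list) \<times> (nat list \<times> nat list)"

definition rewr :: "site_rule list \<Rightarrow> nat list \<Rightarrow> nat list \<Rightarrow> bool" where
  "rewr Rs w w' \<longleftrightarrow> (\<exists>l r l' r' u v x. ((l, r), (l', r')) \<in> set Rs \<and>
     w = u @ l @ v @ l' @ x \<and> w' = u @ r @ v @ r' @ x)"

datatype gen = Init | Hash | Fin | Copy nat | Erase nat | Fst nat | Snd nat

text \<open>\<open>Init\<close> comes first because it is the only generator whose image varies: the
  code of the list of images is then a variable head joined to a constant tail. The letter
  \<open>m\<close> serves as the marker between words.\<close>

definition gens :: "nat \<Rightarrow> nat \<Rightarrow> gen list" where
  "gens m k = Init # [Hash, Fin] @ map Copy [0..<m] @ map Erase [0..<m] @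
     map Fst [0..<k] @ map Snd [0..<k]"

text \<open>The upper word is kept one word ahead: \<open>Init\<close> writes only above, and
  \<open>Fin\<close> lets the lower word catch up by reading the final \<open>z @ [m]\<close>.
  \<open>Erase\<close> reads without writing and so disposes of whatever precedes
  \<open>z\<close>.\<close>

fun upper :: "nat \<Rightarrow> site_rule list \<Rightarrow> nat list \<Rightarrow> gen \<Rightarrow> nat list" where
  "upper m Rs w Init = w @ [m]"
| "upper m Rs w Hash = [m]"
| "upper m Rs w Fin = []"
| "upper m Rs w (Copy a) = [a]"
| "upper m Rs w (Erase a) = []"
| "upper m Rs w (Fst i) = snd (fst (Rs ! i))"
| "upper m Rs w (Snd i) = snd (snd (Rs ! i))"

fun lower :: "nat \<Rightarrow> site_rule list \<Rightarrow> nat list \<Rightarrow> gen \<Rightarrow> nat list" where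
  "lower m Rs z Init = []"
| "lower m Rs z Hash = [m]"
| "lower m Rs z Fin = z @ [m]"
| "lower m Rs z (Copy a) = [a]"
| "lower m Rs z (Erase a) = [a]"
| "lower m Rs z (Fst i) = fst (fst (Rs ! i))"
| "lower m Rs z (Snd i) = fst (snd (Rs ! i))"

text \<open>States: \<open>0\<close> initial, \<open>1\<close> between rule applications, \<open>2\<close> erasing, \<open>3\<close> accepting, \<open>4\<close> sink,
  \<open>5 + i\<close> between the two halves of rule \<open>i\<close>.\<close>

fun dfa_step :: "nat \<Rightarrow> gen \<Rightarrow> nat" where
  "dfa_step q Init = (if q = 0 then 1 else 4)"
| "dfa_step q Hash = (if q = 1 then 1 else 4)"
| "dfa_step q Fin = (if q = 1 \<or> q = 2 then 3 else 4)"
| "dfa_step q (Copy a) = (if q = 1 \<or> 5 \<le> q then q else 4)"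
| "dfa_step q (Erase a) = (if q = 1 \<or> q = 2 then 2 else 4)"
| "dfa_step q (Fst i) = (if q = 1 then 5 + i else 4)"
| "dfa_step q (Snd i) = (if q = 5 + i then 1 else 4)"

lemma foldl_dfa_step_sink [simp]: "foldl dfa_step 4 ys = 4"
proof (induction ys)
  case (Cons y ys)
  then show ?case by (cases y) auto
qed simp

lemma foldl_dfa_step_final: "foldl dfa_step 3 ys = 3 \<longleftrightarrow> ys = []"
proof (cases ys)
  case (Cons y ys')
  then show ?thesis by (cases y) auto
qed simp

lemma split_marker:
  assumes "u @ m # x = l @ y" "m \<notin> set l"
  obtains u' where "u = l @ u'" "u' @ m # x = y"
  using assms by (auto simp: append_eq_append_conv2 Cons_eq_append_conv)

context
  fixes m :: nat and Rs :: "site_rule list" and z :: "nat list"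
  assumes Rs: "\<And>l r l' r'. ((l, r), (l', r')) \<in> set Rs \<Longrightarrow>
      set l \<subseteq> {..<m} \<and> set r \<subseteq> {..<m} \<and> set l' \<subseteq> {..<m} \<and> set r' \<subseteq> {..<m}"
    and z: "set z \<subseteq> {..<m}"
begin

lemma Rs_nth:
  assumes "i < length Rs"
  shows "set (fst (fst (Rs ! i))) \<subseteq> {..<m}" "set (snd (fst (Rs ! i))) \<subseteq> {..<m}"
    "set (fst (snd (Rs ! i))) \<subseteq> {..<m}" "set (snd (snd (Rs ! i))) \<subseteq> {..<m}"
  using Rs[of "fst (fst (Rs ! i))" "snd (fst (Rs ! i))" "fst (snd (Rs ! i))" "snd (snd (Rs ! i))"]
    nth_mem[OF assms] by simp_all

text \<open>The invariant of a partial solution: \<open>p\<close> is the part of the current word already written by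
  the upper homomorphism, and \<open>s\<close> is the part of the previous word not yet read by the lower one.
  The word \<open>p @ s\<close>, where all rules but the current one have been applied in place, is reachable.\<close>

definition history :: "nat list \<Rightarrow> nat \<Rightarrow> nat list \<Rightarrow> nat list \<Rightarrow> bool" where
  "history w q p s \<longleftrightarrow> (if q = 1 then (rewr Rs)\<^sup>*\<^sup>* w (p @ s)
     else if q = 2 then \<exists>e. (rewr Rs)\<^sup>*\<^sup>* w (p @ e @ s)
     else 5 \<le> q \<and> q - 5 < length Rs \<and> (\<exists>a b. p = a @ snd (fst (Rs ! (q - 5))) @ b \<and>
       (rewr Rs)\<^sup>*\<^sup>* w (a @ fst (fst (Rs ! (q - 5))) @ b @ s)))"

text \<open>The equation says that the upper word is ahead by \<open>s @ m # p\<close>. Only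
  \<open>Hash\<close> and \<open>Fin\<close> read \<open>m\<close>, so any other generator must read
  from the front of \<open>s\<close>. A pass may apply any number of rules, hence the closure in
  \<open>history\<close>.\<close>

lemma solution_sound:
  assumes "foldl dfa_step q ys = 3" "q \<noteq> 0" "q \<noteq> 3"
    and "set ys \<subseteq> set (gens m (length Rs))"
    and "s @ m # p @ concat (map (upper m Rs w) ys) = concat (map (lower m Rs z) ys)"
    and "set s \<subseteq> {..<m}" "set p \<subseteq> {..<m}" "history w q p s"
  shows "\<exists>u. (rewr Rs)\<^sup>*\<^sup>* w (u @ z)"
  using assms
proof (induction ys arbitrary: q s p)
  case (Cons y ys)
  note IH = Cons.IH[of "dfa_step q y"]
  have q4: "q \<noteq> 4" using Cons.prems(1) by (cases y) auto
  have y: "y \<in> set (gens m (length Rs))" using Cons.prems by simp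
  show ?case
  proof (cases y)
    case Init
    then show ?thesis using Cons.prems by simp
  next
    case Hash
    then have q: "q = 1" using Cons.prems by (auto split: if_splits)
    from Cons.prems(5) Hash have "s @ m # p @ m # concat (map (upper m Rs w) ys) =
      [] @ m # concat (map (lower m Rs z) ys)" by simp
    moreover have "m \<notin> set s" using Cons.prems by auto
    ultimately have "s = []" "p @ m # concat (map (upper m Rs w) ys) = concat (map (lower m Rs z) ys)"
      by (cases s; auto)+
    then show ?thesis
      using IH[of p "[]"] Cons.prems Hash q by (simp add: history_def)
  next
    case Fin
    then have q: "q = 1 \<or> q = 2" and ys: "ys = []"
      using Cons.prems by (auto simp: foldl_dfa_step_final split: if_splits)
    with Cons.prems(5) Fin have "s @ m # p = z @ [m]" by simp
    then obtain s' where "s = z @ s'" "s' @ m # p = [m]"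
      using split_marker[of s m p z "[m]"] z by auto
    \<comment> \<open>Only one \<open>m\<close> is left to read, so a pass that has already written
      symbols cannot end with \<open>Fin\<close>.\<close>
    then have "s = z" "p = []" by (auto simp: append_eq_Cons_conv)
    with q Cons.prems(8) show ?thesis
      by (auto simp: history_def intro: exI[of _ "[]"] split: if_splits)
  next
    case (Copy a)
    then have a: "a < m" using y by (auto simp: gens_def)
    have q: "q = 1 \<or> 5 \<le> q" using Cons.prems Copy by (auto split: if_splits)
    obtain s' where s': "s = [a] @ s'" "s' @ m # p @ a # concat (map (upper m Rs w) ys) =
        concat (map (lower m Rs z) ys)"
      using split_marker[of s m _ "[a]"] Cons.prems(5) Copy a by auto
    have "history w q (p @ [a]) s'"
      using q Cons.prems(8) s'(1) unfolding history_def
      by (auto split: if_splits) (metis append.assoc append_Cons append_Nil)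
    then show ?thesis
      using IH[of s' "p @ [a]"] Cons.prems Copy q s' a by simp
  next
    case (Erase a)
    then have a: "a < m" using y by (auto simp: gens_def)
    have q: "q = 1 \<or> q = 2" using Cons.prems Erase by (auto split: if_splits)
    obtain s' where s': "s = [a] @ s'" "s' @ m # p @ concat (map (upper m Rs w) ys) =
        concat (map (lower m Rs z) ys)"
      using split_marker[of s m _ "[a]"] Cons.prems(5) Erase a by auto
    have "\<exists>e. (rewr Rs)\<^sup>*\<^sup>* w (p @ e @ a # s')"
      using q Cons.prems(8) s'(1) by (auto simp: history_def intro: exI[of _ "[]"])
    then have "history w 2 p s'"
      unfolding history_def by (metis append.assoc append_Cons append_Nil numeral_eq_one_iff semiring_norm(85))
    then show ?thesis
      using IH[of s' p] Cons.prems Erase q s' by auto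
  next
    case (Fst i)
    then have i: "i < length Rs" using y by (auto simp: gens_def)
    have q: "q = 1" using Cons.prems Fst by (auto split: if_splits)
    have "m \<notin> set (fst (fst (Rs ! i)))" using Rs_nth[OF i] by auto
    then obtain s' where s': "s = fst (fst (Rs ! i)) @ s'"
        "s' @ m # p @ snd (fst (Rs ! i)) @ concat (map (upper m Rs w) ys) = concat (map (lower m Rs z) ys)"
      using split_marker[of s m _ "fst (fst (Rs ! i))"] Cons.prems(5) Fst by auto
    have "history w (5 + i) (p @ snd (fst (Rs ! i))) s'"
      using q Cons.prems(8) s'(1) i unfolding history_def
      by (simp, intro exI[of _ p] exI[of _ "[]"]) simp
    then show ?thesis
      using IH[of s' "p @ snd (fst (Rs ! i))"] Cons.prems Fst q s' Rs_nth[OF i] by simp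
  next
    case (Snd i)
    then have i: "i < length Rs" using y by (auto simp: gens_def)
    have q: "q = 5 + i" using Cons.prems Snd by (auto split: if_splits)
    have "m \<notin> set (fst (snd (Rs ! i)))" using Rs_nth[OF i] by auto
    then obtain s' where s': "s = fst (snd (Rs ! i)) @ s'"
        "s' @ m # p @ snd (snd (Rs ! i)) @ concat (map (upper m Rs w) ys) = concat (map (lower m Rs z) ys)"
      using split_marker[of s m _ "fst (snd (Rs ! i))"] Cons.prems(5) Snd by auto
    obtain a b where p: "p = a @ snd (fst (Rs ! i)) @ b"
      and reach: "(rewr Rs)\<^sup>*\<^sup>* w (a @ fst (fst (Rs ! i)) @ b @ s)"
      using Cons.prems(8) q by (auto simp: history_def)
    have "rewr Rs (a @ fst (fst (Rs ! i)) @ b @ s) ((p @ snd (snd (Rs ! i))) @ s')"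
      unfolding rewr_def using nth_mem[OF i] p s'(1) by (metis append.assoc prod.collapse)
    with reach have "history w 1 (p @ snd (snd (Rs ! i))) s'"
      by (simp add: history_def rtranclp.rtrancl_into_rtrancl)
    then show ?thesis
      using IH[of s' "p @ snd (snd (Rs ! i))"] Cons.prems Snd q s' Rs_nth[OF i] by simp
  qed
qed simp

lemma rewr_letters: "rewr Rs w w' \<Longrightarrow> set w \<subseteq> {..<m} \<Longrightarrow> set w' \<subseteq> {..<m}"
  unfolding rewr_def using Rs by fastforce

lemma foldl_dfa_step_Copy: "q = 1 \<or> 5 \<le> q \<Longrightarrow> foldl dfa_step q (map Copy u) = q"
  by (induction u) auto

lemma foldl_dfa_step_Erase: "q = 1 \<or> q = 2 \<Longrightarrow> foldl dfa_step q (map Erase u) \<in> {1, 2}"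
  by (induction u arbitrary: q) auto

lemma concat_map_Copy:
  "concat (map (upper m Rs w) (map Copy u)) = u" "concat (map (lower m Rs z) (map Copy u)) = u"
  by (induction u) auto

lemma concat_map_Erase:
  "concat (map (upper m Rs w) (map Erase u)) = []" "concat (map (lower m Rs z) (map Erase u)) = u"
  by (induction u) auto

lemma solution_step:
  assumes "rewr Rs v v'" "set v \<subseteq> {..<m}"
  shows "\<exists>ys. set ys \<subseteq> set (gens m (length Rs)) \<and> foldl dfa_step 1 ys = 1 \<and>
    concat (map (lower m Rs z) ys) = v \<and> concat (map (upper m Rs w) ys) = v'"
proof -
  obtain l r l' r' a b c where i: "((l, r), (l', r')) \<in> set Rs"
    and v: "v = a @ l @ b @ l' @ c" and v': "v' = a @ r @ b @ r' @ c"
    using assms(1) unfolding rewr_def by blast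
  from i obtain i where i: "i < length Rs" "Rs ! i = ((l, r), (l', r'))"
    by (auto simp: in_set_conv_nth)
  let ?ys = "map Copy a @ [Fst i] @ map Copy b @ [Snd i] @ map Copy c"
  have "set ?ys \<subseteq> set (gens m (length Rs))"
    using assms(2) v i(1) by (auto simp: gens_def)
  moreover have "foldl dfa_step 1 ?ys = 1"
    by (simp add: foldl_dfa_step_Copy)
  ultimately show ?thesis
    using i(2) v v' concat_map_Copy by (intro exI[of _ ?ys]) simp
qed

text \<open>Here each pass performs exactly one rewriting step and closes with \<open>Hash\<close>;
  after it, the upper word is ahead by the current word and its marker.\<close>

lemma solution_steps:
  assumes "(rewr Rs)\<^sup>*\<^sup>* w v" "set w \<subseteq> {..<m}"
  shows "set v \<subseteq> {..<m} \<and> (\<exists>ys. set ys \<subseteq> set (gens m (length Rs)) \<and> foldl dfa_step 0 ys = 1 \<and>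
    concat (map (upper m Rs w) ys) = concat (map (lower m Rs z) ys) @ v @ [m])"
  using assms
proof (induction rule: rtranclp_induct)
  case base
  then show ?case by (auto simp: gens_def intro: exI[of _ "[Init]"])
next
  case (step v v')
  then obtain ys where ys: "set v \<subseteq> {..<m}" "set ys \<subseteq> set (gens m (length Rs))" "foldl dfa_step 0 ys = 1"
    "concat (map (upper m Rs w) ys) = concat (map (lower m Rs z) ys) @ v @ [m]" by blast
  obtain xs where xs: "set xs \<subseteq> set (gens m (length Rs))" "foldl dfa_step 1 xs = 1"
    "concat (map (lower m Rs z) xs) = v" "concat (map (upper m Rs w) xs) = v'"
    using solution_step[OF step.hyps(2) ys(1)] by blast
  have "Hash \<in> set (gens m (length Rs))" by (simp add: gens_def)
  with ys xs rewr_letters[OF step.hyps(2)] show ?case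
    by (intro conjI exI[of _ "ys @ xs @ [Hash]"]) auto
qed

lemma solution_iff:
  assumes w: "set w \<subseteq> {..<m}"
  shows "(\<exists>ys. set ys \<subseteq> set (gens m (length Rs)) \<and> foldl dfa_step 0 ys = 3 \<and>
      concat (map (upper m Rs w) ys) = concat (map (lower m Rs z) ys)) \<longleftrightarrow>
    (\<exists>u. (rewr Rs)\<^sup>*\<^sup>* w (u @ z))" (is "?l \<longleftrightarrow> ?r")
proof
  assume ?l
  then obtain ys where ys: "set ys \<subseteq> set (gens m (length Rs))" "foldl dfa_step 0 ys = 3"
    "concat (map (upper m Rs w) ys) = concat (map (lower m Rs z) ys)" by blast
  from ys(2) obtain xs where xs: "ys = Init # xs" "foldl dfa_step 1 xs = 3"
  proof (cases ys)
    case (Cons y xs)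
    with ys(2) that show ?thesis by (cases y) auto
  qed simp
  show ?r
    by (rule solution_sound[of 1 xs w "[]"]) (use ys xs w in \<open>auto simp: history_def\<close>)
next
  assume ?r
  then obtain u where "(rewr Rs)\<^sup>*\<^sup>* w (u @ z)" by blast
  from solution_steps[OF this w] obtain ys where u: "set u \<subseteq> {..<m}"
    and ys: "set ys \<subseteq> set (gens m (length Rs))" "foldl dfa_step 0 ys = 1"
      "concat (map (upper m Rs w) ys) = concat (map (lower m Rs z) ys) @ u @ z @ [m]" by auto
  let ?ys = "ys @ map Erase u @ [Fin]"
  have "set ?ys \<subseteq> set (gens m (length Rs))"
    using u ys by (auto simp: gens_def)
  moreover have "foldl dfa_step 0 ?ys = 3"
    using ys(2) foldl_dfa_step_Erase[of 1 u] by auto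
  ultimately show ?l
    using ys(3) concat_map_Erase by (intro exI[of _ ?ys]) simp
qed

end

section \<open>Homomorphisms of free groups and positive words\<close>

definition inv_word :: "'a letter list \<Rightarrow> 'a letter list" where
  "inv_word w = rev (map inv_letter w)"

definition hom_image :: "('a \<Rightarrow> 'b letter list) \<Rightarrow> 'a letter \<Rightarrow> 'b letter list" where
  "hom_image \<phi> x = (if snd x then \<phi> (fst x) else inv_word (\<phi> (fst x)))"

definition free_ext :: "('a \<Rightarrow> 'b letter list) \<Rightarrow> 'a letter list \<Rightarrow> 'b letter list" where
  "free_ext \<phi> w = free_reduce (concat (map (hom_image \<phi>) w))"

lemma inv_word_inv_word [simp]: "inv_word (inv_word w) = w"
  by (simp add: inv_word_def rev_map comp_def del: inv_letter.simps)

lemma free_reduce_inv_word: "free_reduce (inv_word w @ w @ v) = free_reduce v"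
proof -
  have "free_reduce (inv_word w @ w @ v) = free_reduce (free_reduce (inv_word w @ w) @ v)"
    by simp
  then show ?thesis by (simp only: inv_word_def free_reduce_rev_inv append_Nil)
qed

lemma free_reduce_hom_image:
  "free_reduce (hom_image \<phi> x @ hom_image \<phi> (inv_letter x) @ v) = free_reduce v"
proof (cases x)
  case (Pair a e)
  then show ?thesis
    using free_reduce_inv_word[of "\<phi> a" v] free_reduce_inv_word[of "inv_word (\<phi> a)" v]
    by (simp add: hom_image_def)
qed

text \<open>Products in \<open>free_group\<close> are reduced, so this invariance is the core of the
  homomorphism property. It holds because a cancelled pair of letters has cancelling images.\<close>

lemma free_ext_free_reduce: "free_ext \<phi> (free_reduce w) = free_ext \<phi> w"
proof (induction w)
  case (Cons x w)
  have "free_ext \<phi> (push_letter x v) = free_reduce (hom_image \<phi> x @ free_ext \<phi> v)" for v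
    by (cases v) (auto simp: free_ext_def free_reduce_hom_image)
  then have "free_ext \<phi> (free_reduce (x # w)) =
      free_reduce (hom_image \<phi> x @ free_ext \<phi> (free_reduce w))"
    by (simp add: free_reduce_def)
  then show ?case
    by (simp add: Cons.IH) (simp add: free_ext_def)
qed (simp add: free_reduce_def)

lemma free_ext_hom:
  assumes "\<And>a. a \<in> \<Sigma> \<Longrightarrow> \<phi> a \<in> lists (letters \<Delta>)"
  shows "free_ext \<phi> \<in> hom (free_group \<Sigma>) (free_group \<Delta>)"
proof (rule homI)
  have inv: "inv_word w \<in> lists (letters \<Delta>)" if "w \<in> lists (letters \<Delta>)" for w
    using that by (auto simp: inv_word_def simp del: inv_letter.simps)
  have "hom_image \<phi> x \<in> lists (letters \<Delta>)" if "x \<in> letters \<Sigma>" for x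
  proof -
    have "fst x \<in> \<Sigma>" using that by (auto simp: letters_def)
    then show ?thesis by (simp add: hom_image_def inv assms del: in_lists_conv_set)
  qed
  then have img: "concat (map (hom_image \<phi>) w) \<in> lists (letters \<Delta>)" if "w \<in> lists (letters \<Sigma>)" for w
    using that by (induction w) auto
  show "free_ext \<phi> w \<in> carrier (free_group \<Delta>)" if "w \<in> carrier (free_group \<Sigma>)" for w
    using that img[of w] unfolding free_ext_def
    by (intro free_reduce_in_carrier) (simp add: free_group_def del: in_lists_conv_set)
  show "free_ext \<phi> (u \<otimes>\<^bsub>free_group \<Sigma>\<^esub> v) = free_ext \<phi> u \<otimes>\<^bsub>free_group \<Delta>\<^esub> free_ext \<phi> v" for u v
    by (simp add: free_group_def free_ext_free_reduce) (simp add: free_ext_def)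
qed

definition pos_word :: "'a list \<Rightarrow> 'a letter list" where
  "pos_word w = map (\<lambda>a. (a, True)) w"

lemma pos_word_inject: "pos_word u = pos_word v \<longleftrightarrow> u = v"
  by (auto simp: pos_word_def inj_map_eq_map inj_def)

lemma free_reduce_pos_word [simp]: "free_reduce (pos_word w) = pos_word w"
proof (rule free_reduce_id)
  show "freely_reduced (pos_word w)"
    by (induction w rule: induct_list012) (auto simp: pos_word_def freely_reduced_Cons_Cons)
qed

lemma free_ext_pos_word:
  "free_ext (\<lambda>a. pos_word (\<phi> a)) (pos_word w) = pos_word (concat (map \<phi> w))"
proof -
  have "concat (map (hom_image (\<lambda>a. pos_word (\<phi> a))) (pos_word w)) = pos_word (concat (map \<phi> w))"
    by (induction w) (simp_all add: pos_word_def hom_image_def)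
  then show ?thesis by (simp add: free_ext_def)
qed

lemma pos_word_in_lists: "pos_word w \<in> lists (letters \<Delta>) \<longleftrightarrow> set w \<subseteq> \<Delta>"
  by (auto simp: pos_word_def letters_def)

lemma dfa_step_less: "q < 5 + k \<Longrightarrow> y \<in> set (gens m k) \<Longrightarrow> dfa_step q y < 5 + k"
  by (cases y) (auto simp: gens_def)

text \<open>The order of quantifiers matters: \<open>a\<close>, \<open>b\<close> and
  \<open>c\<close> are chosen before \<open>w\<close>, so the code of an instance depends on
  \<open>w\<close> only through the code of \<open>w @ [m]\<close>.\<close>

theorem rewriting_to_pcp:
  assumes Rs: "\<And>l r l' r'. ((l, r), (l', r')) \<in> set Rs \<Longrightarrow>
      set l \<subseteq> {..<m} \<and> set r \<subseteq> {..<m} \<and> set l' \<subseteq> {..<m} \<and> set r' \<subseteq> {..<m}"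
    and z: "set z \<subseteq> {..<m}"
  obtains \<Sigma> :: "nat set" and R a b c where
    "finite \<Sigma>" "rational_subset \<Sigma> R"
    "\<And>w. set w \<subseteq> {..<m} \<Longrightarrow> \<exists>\<Delta> g h. finite \<Delta> \<and>
      g \<in> hom (free_group \<Sigma>) (free_group \<Delta>) \<and> h \<in> hom (free_group \<Sigma>) (free_group \<Delta>) \<and>
      pcp_code \<Sigma> \<Delta> g h =
        prod_encode (a, prod_encode (Suc (prod_encode (word_code (pos_word (w @ [m])), b)), c)) \<and>
      (pcp_solvable \<Sigma> R g h \<longleftrightarrow> (\<exists>u. (rewr Rs)\<^sup>*\<^sup>* w (u @ z)))"
proof -
  define G where "G = gens m (length Rs)"
  define \<Sigma> where "\<Sigma> = {..<length G}"
  define \<Delta> where "\<Delta> = {..<Suc m}"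
  \<comment> \<open>Inverse letters lead to the sink. Hence \<open>L\<close> consists of positive
    words, and the projection to the free group fixes it.\<close>
  define \<delta> :: "nat \<Rightarrow> nat letter \<Rightarrow> nat" where
    "\<delta> q x = (if snd x then dfa_step q (G ! fst x) else 4)" for q x
  define L where "L = {w \<in> lists (letters \<Sigma>). foldl \<delta> 0 w = 3}"
  have \<delta>_sink: "foldl \<delta> 4 w = 4" for w
  proof (induction w)
    case (Cons x w)
    then show ?case using foldl_dfa_step_sink[of "[G ! fst x]"] by (simp add: \<delta>_def)
  qed simp
  have \<delta>_pos: "foldl \<delta> q (pos_word ns) = foldl dfa_step q (map ((!) G) ns)" for q ns
    by (induction ns arbitrary: q) (simp_all add: pos_word_def \<delta>_def)
  have \<delta>_3: "\<exists>ns. w = pos_word ns" if "foldl \<delta> q w = 3" for q w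
    using that
  proof (induction w arbitrary: q)
    case (Cons x w)
    then obtain ns where "w = pos_word ns" by auto
    moreover have "snd x"
    proof (rule ccontr)
      assume "\<not> snd x"
      then have "\<delta> q x = 4" by (simp add: \<delta>_def)
      then show False using Cons.prems \<delta>_sink by simp
    qed
    ultimately have "x # w = pos_word (fst x # ns)" by (cases x) (simp add: pos_word_def)
    then show ?case by blast
  qed (simp add: pos_word_def)
  have L: "L = pos_word ` {ns. set ns \<subseteq> \<Sigma> \<and> foldl dfa_step 0 (map ((!) G) ns) = 3}"
  proof (intro equalityI subsetI)
    fix w assume w: "w \<in> L"
    with \<delta>_3 obtain ns where ns: "w = pos_word ns" unfolding L_def by blast
    with w show "w \<in> pos_word ` {ns. set ns \<subseteq> \<Sigma> \<and> foldl dfa_step 0 (map ((!) G) ns) = 3}"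
      unfolding L_def by (simp only: mem_Collect_eq \<delta>_pos pos_word_in_lists) blast
  next
    fix w assume "w \<in> pos_word ` {ns. set ns \<subseteq> \<Sigma> \<and> foldl dfa_step 0 (map ((!) G) ns) = 3}"
    then show "w \<in> L"
      unfolding L_def by (elim imageE) (simp only: mem_Collect_eq \<delta>_pos pos_word_in_lists simp_thms)
  qed
  have "free_reduce ` L = L"
    unfolding L by (auto simp: image_image)
  moreover have "regular_language (letters \<Sigma>) L"
  proof -
    have "\<delta> q x < 5 + length Rs" if "q < 5 + length Rs" "x \<in> letters \<Sigma>" for q x
      using that dfa_step_less[of q "length Rs" "G ! fst x" m]
      by (auto simp: \<delta>_def letters_def \<Sigma>_def G_def)
    moreover have "L = {w \<in> lists (letters \<Sigma>). foldl \<delta> 0 w \<in> {3}}"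
      by (simp add: L_def)
    moreover have "finite (letters \<Sigma>)" by (simp add: letters_def \<Sigma>_def)
    ultimately show ?thesis
      unfolding regular_language_def
      by (intro conjI exI[of _ "5 + length Rs"] exI[of _ \<delta>] exI[of _ 0] exI[of _ "{3}"]) auto
  qed
  ultimately have rat: "rational_subset \<Sigma> L"
    unfolding rational_subset_def by metis
  define g where "g w = free_ext (\<lambda>n. pos_word (upper m Rs w (G ! n)))" for w
  define h' where "h' = free_ext (\<lambda>n. pos_word (lower m Rs z (G ! n)))"
  have G: "G ! n \<in> set G" if "n \<in> \<Sigma>" for n using that by (simp add: \<Sigma>_def)
  have upper: "set (upper m Rs w y) \<subseteq> \<Delta>" if "set w \<subseteq> {..<m}" "y \<in> set G" for w y
    using that Rs_nth[OF Rs z] by (cases y) (fastforce simp: G_def gens_def \<Delta>_def)+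
  have lower: "set (lower m Rs z y) \<subseteq> \<Delta>" if "y \<in> set G" for y
    using that z Rs_nth[OF Rs z] by (cases y) (fastforce simp: G_def gens_def \<Delta>_def)+
  have hom_g: "g w \<in> hom (free_group \<Sigma>) (free_group \<Delta>)" if "set w \<subseteq> {..<m}" for w
    unfolding g_def by (rule free_ext_hom, unfold pos_word_in_lists) (intro upper that G)
  have hom_h: "h' \<in> hom (free_group \<Sigma>) (free_group \<Delta>)"
    unfolding h'_def by (rule free_ext_hom, unfold pos_word_in_lists) (intro lower G)
  have solvable: "pcp_solvable \<Sigma> L (g w) h' \<longleftrightarrow> (\<exists>u. (rewr Rs)\<^sup>*\<^sup>* w (u @ z))"
    if w: "set w \<subseteq> {..<m}" for w
  proof -
    have gh: "g w (pos_word ns) = h' (pos_word ns) \<longleftrightarrow>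
        concat (map (upper m Rs w) (map ((!) G) ns)) = concat (map (lower m Rs z) (map ((!) G) ns))" for ns
      by (simp add: g_def h'_def free_ext_pos_word pos_word_inject comp_def)
    have "pcp_solvable \<Sigma> L (g w) h' \<longleftrightarrow> (\<exists>ns. set ns \<subseteq> \<Sigma> \<and> foldl dfa_step 0 (map ((!) G) ns) = 3 \<and>
        pos_word ns \<noteq> [] \<and> g w (pos_word ns) = h' (pos_word ns))"
      unfolding pcp_solvable_def L by (auto simp: free_group_def)
    \<comment> \<open>State \<open>0\<close> is not accepting, so the empty word is excluded and
      nontriviality is automatic.\<close>
    also have "\<dots> \<longleftrightarrow> (\<exists>ns. set ns \<subseteq> \<Sigma> \<and> foldl dfa_step 0 (map ((!) G) ns) = 3 \<and>
        concat (map (upper m Rs w) (map ((!) G) ns)) = concat (map (lower m Rs z) (map ((!) G) ns)))"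
      unfolding gh by (auto simp: pos_word_def)
    also have "\<dots> \<longleftrightarrow> (\<exists>ys. set ys \<subseteq> set G \<and> foldl dfa_step 0 ys = 3 \<and>
        concat (map (upper m Rs w) ys) = concat (map (lower m Rs z) ys))"
    proof -
      have "(\<exists>ns. set ns \<subseteq> \<Sigma> \<and> ys = map ((!) G) ns) \<longleftrightarrow> set ys \<subseteq> set G" for ys
      proof
        assume "set ys \<subseteq> set G"
        then show "\<exists>ns. set ns \<subseteq> \<Sigma> \<and> ys = map ((!) G) ns"
        proof (induction ys)
          case (Cons y ys)
          then obtain ns where "set ns \<subseteq> \<Sigma>" "ys = map ((!) G) ns" by auto
          moreover from Cons.prems obtain n where "n \<in> \<Sigma>" "y = G ! n"
            by (auto simp: \<Sigma>_def in_set_conv_nth)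
          ultimately show ?case by (intro exI[of _ "n # ns"]) simp
        qed simp
      next
        assume "\<exists>ns. set ns \<subseteq> \<Sigma> \<and> ys = map ((!) G) ns"
        then obtain ns where "set ns \<subseteq> \<Sigma>" and ys: "ys = map ((!) G) ns" by blast
        then have "G ! n \<in> set G" if "n \<in> set ns" for n using that G by blast
        then show "set ys \<subseteq> set G" unfolding ys by auto
      qed
      then show ?thesis by metis
    qed
    also have "\<dots> \<longleftrightarrow> (\<exists>u. (rewr Rs)\<^sup>*\<^sup>* w (u @ z))"
      unfolding G_def by (rule solution_iff[OF Rs z w])
    finally show ?thesis .
  qed
  have code: "hom_code \<Sigma> (free_ext (\<lambda>n. pos_word (\<phi> (G ! n)))) =
      list_encode (map (\<lambda>y. word_code (pos_word (\<phi> y))) G)" for \<phi>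
  proof -
    have "free_ext (\<lambda>n. pos_word (\<phi> (G ! n))) [(n, True)] = pos_word (\<phi> (G ! n))" for n
      using free_ext_pos_word[of "\<lambda>n. \<phi> (G ! n)" "[n]"] by (simp add: pos_word_def)
    moreover have "sorted_list_of_set \<Sigma> = [0..<length G]"
      by (simp add: \<Sigma>_def lessThan_atLeast0)
    moreover have "map (\<lambda>n. word_code (pos_word (\<phi> (G ! n)))) [0..<length G] =
        map (\<lambda>y. word_code (pos_word (\<phi> y))) G"
      by (rule nth_equalityI) simp_all
    ultimately show ?thesis by (simp add: hom_code_def)
  qed
  define b where "b = list_encode (map (\<lambda>y. word_code (pos_word (upper m Rs [] y))) (tl G))"
  have "hom_code \<Sigma> (g w) = Suc (prod_encode (word_code (pos_word (w @ [m])), b))" for w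
  proof -
    have "upper m Rs w y = upper m Rs [] y" if "y \<in> set (tl G)" for y
      using that by (cases y) (auto simp: G_def gens_def)
    then have "map (\<lambda>y. word_code (pos_word (upper m Rs w y))) (tl G) =
        map (\<lambda>y. word_code (pos_word (upper m Rs [] y))) (tl G)" by simp
    moreover have "list_encode (map f G) = Suc (prod_encode (f Init, list_encode (map f (tl G))))" for f
      by (simp add: G_def gens_def)
    ultimately show ?thesis
      unfolding g_def code b_def by (simp cong: map_cong)
  qed
  then have code: "pcp_code \<Sigma> \<Delta> (g w) h' = prod_encode (set_encode \<Delta>,
      prod_encode (Suc (prod_encode (word_code (pos_word (w @ [m])), b)), hom_code \<Sigma> h'))" for w
    by (simp add: pcp_code_def)
  have fin: "finite \<Sigma>" "finite \<Delta>" by (simp_all add: \<Sigma>_def \<Delta>_def)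
  define a where "a = set_encode \<Delta>"
  show thesis
  proof (rule that[OF fin(1) rat, of a b "hom_code \<Sigma> h'"])
    fix w assume "set w \<subseteq> {..<m}"
    then show "\<exists>\<Delta> g h. finite \<Delta> \<and>
      g \<in> hom (free_group \<Sigma>) (free_group \<Delta>) \<and> h \<in> hom (free_group \<Sigma>) (free_group \<Delta>) \<and>
      pcp_code \<Sigma> \<Delta> g h = prod_encode (a,
        prod_encode (Suc (prod_encode (word_code (pos_word (w @ [m])), b)), hom_code \<Sigma> h')) \<and>
      (pcp_solvable \<Sigma> L g h \<longleftrightarrow> (\<exists>u. (rewr Rs)\<^sup>*\<^sup>* w (u @ z)))"
      by - (rule exI[of _ \<Delta>], rule exI[of _ "g w"], rule exI[of _ h'],
          simp add: fin hom_g hom_h solvable code a_def)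
  qed
qed

section \<open>A universal rewriting system\<close>

text \<open>The words have the form \<open>Dol tape Pct program\<close>. A tape cell with value \<open>n\<close> is \<open>One\<^sup>n Bar\<close>; the
  head \<open>Cur\<close> and the program pointer \<open>Ptr\<close> stand in front of the symbol that they scan. The
  instructions \<open>Rgt\<close> (next cell) and \<open>Hom\<close> (first cell) take several rewriting steps, during which
  the pointer does not move. At the separator \<open>Sep\<close> that ends a block the pointer returns to \<open>Pct\<close>,
  from where it may jump to any block.\<close>

abbreviation (input) One :: nat where "One \<equiv> 0"
abbreviation (input) Bar :: nat where "Bar \<equiv> 1"
abbreviation (input) Cur :: nat where "Cur \<equiv> 2"
abbreviation (input) Dol :: nat where "Dol \<equiv> 3"
abbreviation (input) Add :: nat where "Add \<equiv> 4"
abbreviation (input) Sub :: nat where "Sub \<equiv> 5"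
abbreviation (input) Zer :: nat where "Zer \<equiv> 6"
abbreviation (input) Rgt :: nat where "Rgt \<equiv> 7"
abbreviation (input) Hom :: nat where "Hom \<equiv> 8"
abbreviation (input) Sep :: nat where "Sep \<equiv> 9"
abbreviation (input) Pct :: nat where "Pct \<equiv> 10"
abbreviation (input) Ptr :: nat where "Ptr \<equiv> 11"

text \<open>In most rules the first site is the head and the second the pointer. The last two rules
  move the pointer itself; in the final one \<open>[Sep]\<close> matches any separator to its right,
  which is the nondeterministic jump.\<close>

definition machine :: "site_rule list" where
  "machine =
    [(([Cur], [Cur, One]), ([Ptr, Add], [Add, Ptr])),
     (([Cur, One], [Cur]), ([Ptr, Sub], [Sub, Ptr])),
     (([Cur, Bar], [Cur, Bar]), ([Ptr, Zer], [Zer, Ptr])),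
     (([Cur, One], [One, Cur]), ([Ptr, Rgt], [Ptr, Rgt])),
     (([Cur, Bar], [Bar, Cur]), ([Ptr, Rgt], [Rgt, Ptr])),
     (([One, Cur], [Cur, One]), ([Ptr, Hom], [Ptr, Hom])),
     (([Bar, Cur], [Cur, Bar]), ([Ptr, Hom], [Ptr, Hom])),
     (([Dol, Cur], [Dol, Cur]), ([Ptr, Hom], [Hom, Ptr])),
     (([Pct], [Pct, Ptr]), ([Ptr, Sep], [Sep])),
     (([Pct, Ptr], [Pct]), ([Sep], [Sep, Ptr]))]"

type_synonym config = "nat list \<times> nat list \<times> nat list \<times> nat list"

fun config_word :: "config \<Rightarrow> nat list" where
  "config_word (a, b, p, q) = Dol # a @ Cur # b @ Pct # p @ Ptr # q"

fun wf_config :: "config \<Rightarrow> bool" where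
  "wf_config (a, b, p, q) \<longleftrightarrow> set a \<subseteq> {One, Bar} \<and> set b \<subseteq> {One, Bar} \<and>
     set p \<subseteq> {Add..Sep} \<and> set q \<subseteq> {Add..Sep}"

inductive mstep :: "config \<Rightarrow> config \<Rightarrow> bool" where
  "mstep (a, b, p, Add # q) (a, One # b, p @ [Add], q)"
| "mstep (a, One # b, p, Sub # q) (a, b, p @ [Sub], q)"
| "mstep (a, Bar # b, p, Zer # q) (a, Bar # b, p @ [Zer], q)"
| "mstep (a, One # b, p, Rgt # q) (a @ [One], b, p, Rgt # q)"
| "mstep (a, Bar # b, p, Rgt # q) (a @ [Bar], b, p @ [Rgt], q)"
| "mstep (a @ [c], b, p, Hom # q) (a, c # b, p, Hom # q)"
| "mstep ([], b, p, Hom # q) ([], b, p @ [Hom], q)"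
| "mstep (a, b, p, Sep # q) (a, b, [], p @ Sep # q)"
| "mstep (a, b, [], p @ Sep # q) (a, b, p @ [Sep], q)"

text \<open>\<open>Cur\<close>, \<open>Pct\<close> and \<open>Ptr\<close> each occur once in the
  word of a well-formed configuration, so this fixes the place where a rule matches.\<close>

lemma append_unique_marker:
  "a @ c # b = a' @ c # b' \<Longrightarrow> c \<notin> set a' \<Longrightarrow> c \<notin> set b' \<Longrightarrow> a = a' \<and> b = b'"
  by (auto simp: append_eq_append_conv2 Cons_eq_append_conv append_eq_Cons_conv)

lemma enc_Ptr:
  "wf_config (a, b, p, q) \<Longrightarrow> y @ Ptr # x = config_word (a, b, p, q) \<Longrightarrow> y = Dol # a @ Cur # b @ Pct # p \<and> x = q"
  by (rule append_unique_marker[of _ Ptr]) auto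

lemma enc_Cur:
  "wf_config (a, b, p, q) \<Longrightarrow> y @ Cur # x = Dol # a @ Cur # b @ Pct # p \<Longrightarrow> y = Dol # a \<and> x = b @ Pct # p"
  by (rule append_unique_marker[of _ Cur]) auto

lemma enc_Pct:
  "wf_config (a, b, p, q) \<Longrightarrow> y @ Pct # x = Dol # a @ Cur # b @ Pct # p \<Longrightarrow>
     y = Dol # a @ Cur # b \<and> x = p"
  by (rule append_unique_marker[of _ Pct]) auto

lemma rewr_enc_imp_mstep:
  assumes wf_config: "wf_config (a, b, p, q)" and "rewr machine (config_word (a, b, p, q)) w"
  shows "\<exists>c. mstep (a, b, p, q) c \<and> w = config_word c"
proof -
  obtain l r l' r' u v x where rule: "((l, r), (l', r')) \<in> set machine"
    and eq: "u @ l @ v @ l' @ x = config_word (a, b, p, q)" and w: "w = u @ r @ v @ r' @ x"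
    using assms(2) unfolding rewr_def by metis
  note Ptr = enc_Ptr[OF wf_config] and Cur = enc_Cur[OF wf_config] and Pct = enc_Pct[OF wf_config]
  from rule have "((l, r), (l', r')) = machine ! 0 \<or> ((l, r), (l', r')) = machine ! 1 \<or>
      ((l, r), (l', r')) = machine ! 2 \<or> ((l, r), (l', r')) = machine ! 3 \<or>
      ((l, r), (l', r')) = machine ! 4 \<or> ((l, r), (l', r')) = machine ! 5 \<or>
      ((l, r), (l', r')) = machine ! 6 \<or> ((l, r), (l', r')) = machine ! 7 \<or>
      ((l, r), (l', r')) = machine ! 8 \<or> ((l, r), (l', r')) = machine ! 9"
    unfolding machine_def by simp
  then consider
      (add) "l = [Cur]" "r = [Cur, One]" "l' = [Ptr, Add]" "r' = [Add, Ptr]"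
    | (sub) "l = [Cur, One]" "r = [Cur]" "l' = [Ptr, Sub]" "r' = [Sub, Ptr]"
    | (zer) "l = [Cur, Bar]" "r = [Cur, Bar]" "l' = [Ptr, Zer]" "r' = [Zer, Ptr]"
    | (rgt_One) "l = [Cur, One]" "r = [One, Cur]" "l' = [Ptr, Rgt]" "r' = [Ptr, Rgt]"
    | (rgt_Bar) "l = [Cur, Bar]" "r = [Bar, Cur]" "l' = [Ptr, Rgt]" "r' = [Rgt, Ptr]"
    | (hom) c where "l = [c, Cur]" "r = [Cur, c]" "l' = [Ptr, Hom]" "r' = [Ptr, Hom]" "c \<noteq> Dol"
    | (hom_Dol) "l = [Dol, Cur]" "r = [Dol, Cur]" "l' = [Ptr, Hom]" "r' = [Hom, Ptr]"
    | (ret) "l = [Pct]" "r = [Pct, Ptr]" "l' = [Ptr, Sep]" "r' = [Sep]"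
    | (jmp) "l = [Pct, Ptr]" "r = [Pct]" "l' = [Sep]" "r' = [Sep, Ptr]"
    unfolding machine_def by (elim disjE) simp_all
  then show ?thesis
  proof cases
    case add
    then have "u @ Cur # v = Dol # a @ Cur # b @ Pct # p" "Add # x = q"
      using Ptr[of "u @ Cur # v" "Add # x"] eq by auto
    then have *: "u = Dol # a" "v = b @ Pct # p" "q = Add # x"
      using Cur[of u v] by auto
    show ?thesis unfolding w add *
      by (intro exI[of _ "(a, One # b, p @ [Add], x)"]) (simp add: mstep.intros del: One_nat_def)
  next
    case sub
    then have "u @ Cur # One # v = Dol # a @ Cur # b @ Pct # p" "Sub # x = q"
      using Ptr[of "u @ Cur # One # v" "Sub # x"] eq by auto
    then have "u = Dol # a" "One # v = b @ Pct # p" "q = Sub # x"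
      using Cur[of u "One # v"] by auto
    then obtain b' where *: "u = Dol # a" "b = One # b'" "v = b' @ Pct # p" "q = Sub # x"
      by (auto simp: Cons_eq_append_conv)
    show ?thesis unfolding w sub *
      by (intro exI[of _ "(a, b', p @ [Sub], x)"]) (simp add: mstep.intros del: One_nat_def)
  next
    case zer
    then have "u @ Cur # Bar # v = Dol # a @ Cur # b @ Pct # p" "Zer # x = q"
      using Ptr[of "u @ Cur # Bar # v" "Zer # x"] eq by auto
    then have "u = Dol # a" "Bar # v = b @ Pct # p" "q = Zer # x"
      using Cur[of u "Bar # v"] by auto
    then obtain b' where *: "u = Dol # a" "b = Bar # b'" "v = b' @ Pct # p" "q = Zer # x"
      by (auto simp: Cons_eq_append_conv)
    show ?thesis unfolding w zer *
      by (intro exI[of _ "(a, Bar # b', p @ [Zer], x)"]) (simp add: mstep.intros del: One_nat_def)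
  next
    case rgt_One
    then have "u @ Cur # One # v = Dol # a @ Cur # b @ Pct # p" "Rgt # x = q"
      using Ptr[of "u @ Cur # One # v" "Rgt # x"] eq by auto
    then have "u = Dol # a" "One # v = b @ Pct # p" "q = Rgt # x"
      using Cur[of u "One # v"] by auto
    then obtain b' where *: "u = Dol # a" "b = One # b'" "v = b' @ Pct # p" "q = Rgt # x"
      by (auto simp: Cons_eq_append_conv)
    show ?thesis unfolding w rgt_One *
      by (intro exI[of _ "(a @ [One], b', p, Rgt # x)"]) (simp add: mstep.intros del: One_nat_def)
  next
    case rgt_Bar
    then have "u @ Cur # Bar # v = Dol # a @ Cur # b @ Pct # p" "Rgt # x = q"
      using Ptr[of "u @ Cur # Bar # v" "Rgt # x"] eq by auto
    then have "u = Dol # a" "Bar # v = b @ Pct # p" "q = Rgt # x"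
      using Cur[of u "Bar # v"] by auto
    then obtain b' where *: "u = Dol # a" "b = Bar # b'" "v = b' @ Pct # p" "q = Rgt # x"
      by (auto simp: Cons_eq_append_conv)
    show ?thesis unfolding w rgt_Bar *
      by (intro exI[of _ "(a @ [Bar], b', p @ [Rgt], x)"]) (simp add: mstep.intros del: One_nat_def)
  next
    case (hom c)
    then have "(u @ [c]) @ Cur # v = Dol # a @ Cur # b @ Pct # p" "Hom # x = q"
      using Ptr[of "(u @ [c]) @ Cur # v" "Hom # x"] eq by auto
    then have "u @ [c] = Dol # a" "v = b @ Pct # p" "q = Hom # x"
      using Cur[of "u @ [c]" v] by auto
    then obtain a' where *: "u = Dol # a'" "a = a' @ [c]" "v = b @ Pct # p" "q = Hom # x"
      using hom(5) by (cases u) auto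
    show ?thesis unfolding w hom *
      by (intro exI[of _ "(a', c # b, p, Hom # x)"]) (simp add: mstep.intros del: One_nat_def)
  next
    case hom_Dol
    then have "(u @ [Dol]) @ Cur # v = Dol # a @ Cur # b @ Pct # p" "Hom # x = q"
      using Ptr[of "(u @ [Dol]) @ Cur # v" "Hom # x"] eq by auto
    then have "u @ [Dol] = Dol # a" "v = b @ Pct # p" "q = Hom # x"
      using Cur[of "u @ [Dol]" v] by auto
    moreover have "Dol \<notin> set a" using wf_config by auto
    ultimately have *: "u = []" "a = []" "v = b @ Pct # p" "q = Hom # x"
      by (cases u; auto)+
    show ?thesis unfolding w hom_Dol *
      by (intro exI[of _ "([], b, p @ [Hom], x)"]) (simp add: mstep.intros del: One_nat_def)
  next
    case ret
    then have "u @ Pct # v = Dol # a @ Cur # b @ Pct # p" "Sep # x = q"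
      using Ptr[of "u @ Pct # v" "Sep # x"] eq by auto
    then have *: "u = Dol # a @ Cur # b" "v = p" "q = Sep # x"
      using Pct[of u v] by auto
    show ?thesis unfolding w ret *
      by (intro exI[of _ "(a, b, [], p @ Sep # x)"]) (simp add: mstep.intros del: One_nat_def)
  next
    case jmp
    then have "u @ Pct # [] = Dol # a @ Cur # b @ Pct # p" "v @ Sep # x = q"
      using Ptr[of "u @ [Pct]" "v @ Sep # x"] eq by auto
    then have *: "u = Dol # a @ Cur # b" "p = []" "q = v @ Sep # x"
      using Pct[of u "[]"] by auto
    show ?thesis unfolding w jmp *
      by (intro exI[of _ "(a, b, v @ [Sep], x)"]) (simp add: mstep.intros del: One_nat_def)
  qed
qed

lemma wf_config_mstep: "mstep c c' \<Longrightarrow> wf_config c \<Longrightarrow> wf_config c'"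
  by (induction rule: mstep.induct) auto

lemma rewrI:
  "((l, r), (l', r')) \<in> set Rs \<Longrightarrow> w = u @ l @ v @ l' @ x \<Longrightarrow> w' = u @ r @ v @ r' @ x \<Longrightarrow> rewr Rs w w'"
  unfolding rewr_def by blast

lemma mstep_imp_rewr:
  assumes "mstep c c'" "wf_config c"
  shows "rewr machine (config_word c) (config_word c')"
  using assms
proof (induction rule: mstep.induct)
  case (1 a b p q)
  show ?case
    by (rule rewrI[of "[Cur]" "[Cur, One]" "[Ptr, Add]" "[Add, Ptr]" _ _ "Dol # a" "b @ Pct # p" q])
      (simp_all add: machine_def)
next
  case (2 a b p q)
  show ?case
    by (rule rewrI[of "[Cur, One]" "[Cur]" "[Ptr, Sub]" "[Sub, Ptr]" _ _ "Dol # a" "b @ Pct # p" q])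
      (simp_all add: machine_def)
next
  case (3 a b p q)
  show ?case
    by (rule rewrI[of "[Cur, Bar]" "[Cur, Bar]" "[Ptr, Zer]" "[Zer, Ptr]" _ _ "Dol # a" "b @ Pct # p" q])
      (simp_all add: machine_def)
next
  case (4 a b p q)
  show ?case
    by (rule rewrI[of "[Cur, One]" "[One, Cur]" "[Ptr, Rgt]" "[Ptr, Rgt]" _ _ "Dol # a" "b @ Pct # p" q])
      (simp_all add: machine_def)
next
  case (5 a b p q)
  show ?case
    by (rule rewrI[of "[Cur, Bar]" "[Bar, Cur]" "[Ptr, Rgt]" "[Rgt, Ptr]" _ _ "Dol # a" "b @ Pct # p" q])
      (simp_all add: machine_def)
next
  case (6 a c b p q)
  then have "c = One \<or> c = Bar" by auto
  then show ?case
    by (intro rewrI[of "[c, Cur]" "[Cur, c]" "[Ptr, Hom]" "[Ptr, Hom]" _ _ "Dol # a" "b @ Pct # p" q])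
      (auto simp: machine_def)
next
  case (7 b p q)
  show ?case
    by (rule rewrI[of "[Dol, Cur]" "[Dol, Cur]" "[Ptr, Hom]" "[Hom, Ptr]" _ _ "[]" "b @ Pct # p" q])
      (simp_all add: machine_def)
next
  case (8 a b p q)
  show ?case
    by (rule rewrI[of "[Pct]" "[Pct, Ptr]" "[Ptr, Sep]" "[Sep]" _ _ "Dol # a @ Cur # b" p q])
      (simp_all add: machine_def)
next
  case (9 a b p q)
  show ?case
    by (rule rewrI[of "[Pct, Ptr]" "[Pct]" "[Sep]" "[Sep, Ptr]" _ _ "Dol # a @ Cur # b" p q])
      (simp_all add: machine_def)
qed

lemma rewrs_enc:
  assumes "wf_config c"
  shows "(rewr machine)\<^sup>*\<^sup>* (config_word c) w \<longleftrightarrow> (\<exists>c'. mstep\<^sup>*\<^sup>* c c' \<and> w = config_word c')"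
proof
  assume "(rewr machine)\<^sup>*\<^sup>* (config_word c) w"
  then have "\<exists>c'. mstep\<^sup>*\<^sup>* c c' \<and> wf_config c' \<and> w = config_word c'"
  proof (induction rule: rtranclp_induct)
    case base
    then show ?case using assms by blast
  next
    case (step y z)
    then obtain c' where c': "mstep\<^sup>*\<^sup>* c c'" "wf_config c'" "rewr machine (config_word c') z" by blast
    then obtain c'' where "mstep c' c''" "z = config_word c''"
      using rewr_enc_imp_mstep by (metis prod_cases4)
    moreover have "mstep\<^sup>*\<^sup>* c c''" using c'(1) calculation(1) by (rule rtranclp.rtrancl_into_rtrancl)
    ultimately show ?case using c'(2) wf_config_mstep by blast
  qed
  then show "\<exists>c'. mstep\<^sup>*\<^sup>* c c' \<and> w = config_word c'" by blast
next
  assume "\<exists>c'. mstep\<^sup>*\<^sup>* c c' \<and> w = config_word c'"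
  then obtain c' where "mstep\<^sup>*\<^sup>* c c'" and w: "w = config_word c'" by blast
  from this(1) have "(rewr machine)\<^sup>*\<^sup>* (config_word c) (config_word c') \<and> wf_config c'"
  proof (induction rule: rtranclp_induct)
    case (step y z)
    then show ?case using mstep_imp_rewr wf_config_mstep by (meson rtranclp.rtrancl_into_rtrancl)
  qed (use assms in auto)
  with w show "(rewr machine)\<^sup>*\<^sup>* (config_word c) w" by blast
qed

section \<open>Completed instructions and blocks\<close>

type_synonym tape = "nat list \<times> nat list"

text \<open>\<open>Rgt\<close> and \<open>Hom\<close> may take many rewriting steps; here each
  instruction is a single step to its completed effect.\<close>

inductive micro :: "nat \<Rightarrow> tape \<Rightarrow> tape \<Rightarrow> bool" where
  "micro Add (a, b) (a, One # b)"
| "micro Sub (a, One # b) (a, b)"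
| "micro Zer (a, Bar # b) (a, Bar # b)"
| "micro Rgt (a, replicate k One @ Bar # b) (a @ replicate k One @ [Bar], b)"
| "micro Hom (a, b) ([], a @ b)"

fun micros :: "nat list \<Rightarrow> tape \<Rightarrow> tape \<Rightarrow> bool" where
  "micros [] s t \<longleftrightarrow> t = s"
| "micros (x # xs) s t \<longleftrightarrow> (\<exists>u. micro x s u \<and> micros xs u t)"

lemma micro_iff:
  "micro Add s t \<longleftrightarrow> t = (fst s, One # snd s)"
  "micro Sub s t \<longleftrightarrow> (\<exists>b. s = (fst t, One # b) \<and> snd t = b)"
  "micro Zer s t \<longleftrightarrow> (\<exists>b. snd s = Bar # b) \<and> t = s"
  "micro Rgt s t \<longleftrightarrow> (\<exists>k b. snd s = replicate k One @ Bar # b \<and> t = (fst s @ replicate k One @ [Bar], b))"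
  "micro Hom s t \<longleftrightarrow> t = ([], fst s @ snd s)"
  by (cases s; cases t; auto simp: micro.simps)+

lemma micros_append: "micros (xs @ ys) s t \<longleftrightarrow> (\<exists>u. micros xs s u \<and> micros ys u t)"
  by (induction xs arbitrary: s) auto

definition prog_text :: "nat list list \<Rightarrow> nat list" where
  "prog_text bs = concat (map (\<lambda>b. Sep # b) bs)"

definition tape_accepts :: "nat list list \<Rightarrow> tape \<Rightarrow> bool" where
  "tape_accepts bs s \<longleftrightarrow> (\<exists>t u. (\<lambda>s t. \<exists>b\<in>set bs. micros b s t)\<^sup>*\<^sup>* s t \<and> micros (last bs) t u)"

lemma tape_accepts_last: "micros (last bs) s t \<Longrightarrow> tape_accepts bs s"
  unfolding tape_accepts_def by blast

lemma tape_accepts_step: "b \<in> set bs \<Longrightarrow> micros b s t \<Longrightarrow> tape_accepts bs t \<Longrightarrow> tape_accepts bs s"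
proof -
  let ?R = "\<lambda>s t. \<exists>b\<in>set bs. micros b s t"
  assume "b \<in> set bs" "micros b s t" "tape_accepts bs t"
  then obtain t' u where "?R s t" "?R\<^sup>*\<^sup>* t t'" "micros (last bs) t' u"
    unfolding tape_accepts_def by blast
  moreover from this(1,2) have "?R\<^sup>*\<^sup>* s t'" by (rule converse_rtranclp_into_rtranclp)
  ultimately show "tape_accepts bs s" unfolding tape_accepts_def by blast
qed

lemma prog_text_split:
  assumes "prog_text bs = p @ Sep # q" "\<forall>b\<in>set bs. Sep \<notin> set b"
  obtains b bs' where "q = b @ prog_text bs'" "b \<in> set bs" "bs' = [] \<Longrightarrow> b = last bs"
  using assms
proof (induction bs arbitrary: p thesis)
  case (Cons b bs)
  show ?case
  proof (cases p)
    case Nil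
    with Cons.prems show ?thesis by (auto simp: prog_text_def)
  next
    case (Cons x p')
    then have "b @ prog_text bs = p' @ Sep # q" using Cons.prems(2) by (simp add: prog_text_def)
    moreover have "Sep \<notin> set b" using Cons.prems by simp
    ultimately obtain p'' where "prog_text bs = p'' @ Sep # q"
      by (fastforce simp: append_eq_append_conv2 Cons_eq_append_conv append_eq_Cons_conv)
    with Cons.IH Cons.prems(3) obtain c bs' where
      c: "q = c @ prog_text bs'" "c \<in> set bs" "bs' = [] \<Longrightarrow> c = last bs"
      by (metis list.set_intros(2))
    show ?thesis
      by (rule Cons.prems(1)[of c bs']) (use c in auto)
  qed
qed (simp add: prog_text_def)

lemma takeWhile_block:
  assumes "Sep \<notin> set b"
  shows "takeWhile (\<lambda>x. x \<noteq> Sep) (b @ prog_text bs) = b" "Sep \<in> set (b @ prog_text bs) \<longleftrightarrow> bs \<noteq> []"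
proof -
  have "prog_text bs = [] \<or> (\<exists>q. prog_text bs = Sep # q)" by (cases bs) (auto simp: prog_text_def)
  then show "takeWhile (\<lambda>x. x \<noteq> Sep) (b @ prog_text bs) = b"
    using assms by (auto simp: takeWhile_append takeWhile_eq_all_conv)
  show "Sep \<in> set (b @ prog_text bs) \<longleftrightarrow> bs \<noteq> []"
    using assms by (cases bs) (auto simp: prog_text_def)
qed

text \<open>Acceptance of a configuration is propagated backwards along \<open>mstep\<close>: finish the block under
  the program pointer, then continue with arbitrary blocks unless the program ends there.\<close>

definition config_accepts :: "nat list list \<Rightarrow> config \<Rightarrow> bool" where
  "config_accepts bs c = (case c of (a, b, p, q) \<Rightarrow>
     \<exists>t. micros (takeWhile (\<lambda>x. x \<noteq> Sep) q) (a, b) t \<and> (Sep \<in> set q \<longrightarrow> tape_accepts bs t))"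

definition prog :: "config \<Rightarrow> nat list" where
  "prog c = (case c of (a, b, p, q) \<Rightarrow> p @ q)"

lemma prog_mstep: "mstep c c' \<Longrightarrow> prog c' = prog c"
  by (induction rule: mstep.induct) (auto simp: prog_def)

text \<open>A nonempty program text begins with \<open>Sep\<close>, so nothing is left of the block
  under the pointer.\<close>

lemma config_accepts_start: "bs \<noteq> [] \<Longrightarrow> config_accepts bs (a, b, p, prog_text bs) \<longleftrightarrow> tape_accepts bs (a, b)"
  by (cases bs) (auto simp: config_accepts_def prog_text_def)

text \<open>Going backwards avoids recording how far \<open>Rgt\<close> or \<open>Hom\<close> has
  got: what remains of such an instruction is the same instruction started at the present head
  position.\<close>

lemma config_accepts_mstep:
  assumes "mstep c c'" "config_accepts bs c'" "prog c = prog_text bs" "bs \<noteq> []" "\<forall>b\<in>set bs. Sep \<notin> set b"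
  shows "config_accepts bs c"
  using assms
proof (induction rule: mstep.induct)
  case (4 a b p q)
  let ?q = "takeWhile (\<lambda>x. x \<noteq> Sep) q"
  from 4(1) obtain u t where t: "micro Rgt (a @ [One], b) u" "micros ?q u t" "Sep \<in> set q \<longrightarrow> tape_accepts bs t"
    by (auto simp: config_accepts_def)
  from t(1) obtain k b' where "b = replicate k One @ Bar # b'" "u = (a @ [One] @ replicate k One @ [Bar], b')"
    by (auto simp: micro_iff)
  then have "micro Rgt (a, One # b) u"
    unfolding micro_iff by (intro exI[of _ "Suc k"] exI[of _ b']) simp
  with t have "micros (Rgt # ?q) (a, One # b) t" unfolding micros.simps by blast
  moreover have "takeWhile (\<lambda>x. x \<noteq> Sep) (Rgt # q) = Rgt # ?q" by simp
  moreover have "Sep \<in> set (Rgt # q) \<longleftrightarrow> Sep \<in> set q" by simp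
  ultimately show ?case
    using t(3) unfolding config_accepts_def prod.case by metis
next
  case (5 a b p q)
  have "micro Rgt (a, Bar # b) (a @ [Bar], b)"
    by (auto simp: micro_iff intro: exI[of _ 0])
  with 5 show ?case by (auto simp: config_accepts_def)
next
  case (6 a c b p q)
  then show ?case by (auto simp: config_accepts_def micro_iff)
next
  case (8 a b p q)
  then have "p @ Sep # q = prog_text bs" by (simp add: prog_def)
  with 8 config_accepts_start show ?case by (auto simp: config_accepts_def)
next
  case (9 a b p q)
  then have "prog_text bs = p @ Sep # q" by (simp add: prog_def)
  then obtain c bs' where c: "q = c @ prog_text bs'" "c \<in> set bs" "bs' = [] \<Longrightarrow> c = last bs"
    using prog_text_split 9(4) by metis
  then have "Sep \<notin> set c" using 9 by auto
  note block = takeWhile_block[OF this, of bs']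
  obtain t where t: "micros c (a, b) t" "bs' \<noteq> [] \<Longrightarrow> tape_accepts bs t"
    using 9(1) unfolding config_accepts_def c(1) prod.case block by blast
  \<comment> \<open>If no block follows, \<open>c\<close> is the last block and its completion
    accepts; otherwise it is an ordinary step before acceptance from \<open>t\<close>.\<close>
  then have "tape_accepts bs (a, b)" using c(2,3) tape_accepts_last tape_accepts_step by metis
  with 9 config_accepts_start \<open>prog_text bs = p @ Sep # q\<close> show ?case by (metis append_Nil)
qed (auto simp: config_accepts_def micro_iff)

lemma config_accepts_msteps:
  assumes "mstep\<^sup>*\<^sup>* (a, b, [], prog_text bs) (a', b', p', [])" "bs \<noteq> []" "\<forall>b\<in>set bs. Sep \<notin> set b"
  shows "tape_accepts bs (a, b)"
proof -
  have "prog c = prog_text bs \<Longrightarrow> config_accepts bs c"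
    if "mstep\<^sup>*\<^sup>* c (a', b', p', [])" for c
    using that
  proof (induction rule: converse_rtranclp_induct)
    case base
    show ?case by (simp add: config_accepts_def)
  next
    case (step y z)
    then show ?case using assms config_accepts_mstep prog_mstep by metis
  qed
  from this[OF assms(1)] show ?thesis
    using config_accepts_start[OF assms(2)] by (simp add: prog_def)
qed

lemma msteps_right:
  "mstep\<^sup>*\<^sup>* (a, replicate k One @ b, p, Rgt # q) (a @ replicate k One, b, p, Rgt # q)"
proof (induction k arbitrary: a)
  case (Suc k)
  have "mstep (a, One # replicate k One @ b, p, Rgt # q) (a @ [One], replicate k One @ b, p, Rgt # q)"
    by (rule mstep.intros)
  with Suc[of "a @ [One]"] show ?case
    by (simp add: converse_rtranclp_into_rtranclp)
qed simp

lemma msteps_home: "mstep\<^sup>*\<^sup>* (a, b, p, Hom # q) ([], a @ b, p, Hom # q)"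
proof (induction a arbitrary: b rule: rev_induct)
  case (snoc c a)
  have "mstep (a @ [c], b, p, Hom # q) (a, c # b, p, Hom # q)"
    by (rule mstep.intros)
  with snoc[of "c # b"] show ?case
    by (simp add: converse_rtranclp_into_rtranclp)
qed simp

lemma micro_msteps:
  assumes "micro x (a, b) (a', b')"
  shows "mstep\<^sup>*\<^sup>* (a, b, p, x # q) (a', b', p @ [x], q)"
  using assms
proof cases
  case (4 k)
  have "mstep (a @ replicate k One, Bar # b', p, Rgt # q) ((a @ replicate k One) @ [Bar], b', p @ [Rgt], q)"
    by (rule mstep.intros)
  with msteps_right[of a k "Bar # b'" p q] show ?thesis
    unfolding 4 append_assoc by (rule rtranclp.rtrancl_into_rtrancl)
next
  case 5
  show ?thesis
    unfolding 5 by (rule rtranclp.rtrancl_into_rtrancl[OF msteps_home mstep.intros(7)])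
qed (simp_all only:, (rule r_into_rtranclp, rule mstep.intros)+)

lemma micros_msteps:
  "micros xs s t \<Longrightarrow> mstep\<^sup>*\<^sup>* (fst s, snd s, p, xs @ q) (fst t, snd t, p @ xs, q)"
proof (induction xs arbitrary: s p)
  case (Cons x xs)
  then obtain u where "micro x s u" "micros xs u t" by auto
  with Cons.IH[of u "p @ [x]"] micro_msteps[of x "fst s" "snd s" "fst u" "snd u" p "xs @ q"]
  show ?case by simp
qed simp

lemma block_msteps:
  assumes "b \<in> set bs" "micros b s t"
  obtains p q where "mstep\<^sup>*\<^sup>* (fst s, snd s, [], prog_text bs) (fst t, snd t, p, q)"
    "p @ q = prog_text bs" "q = [] \<or> (\<exists>q'. q = Sep # q')" "b = last bs \<Longrightarrow> q = []"
proof -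
  from assms(1) obtain bs1 bs2 where bs: "bs = bs1 @ b # bs2" "b = last bs \<Longrightarrow> bs2 = []"
  \<comment> \<open>A block may occur several times. If it equals the last one, the jump must go to
    the last position, where its end is the end of the program.\<close>
  proof (cases "b = last bs")
    case True
    moreover have "bs \<noteq> []" using assms(1) by auto
    ultimately show ?thesis
      using that[of "butlast bs" "[]"] by simp
  next
    case False
    from split_list[OF assms(1)] obtain bs1 bs2 where "bs = bs1 @ b # bs2" by blast
    then show ?thesis by (rule that) (use False in simp)
  qed
  let ?p = "prog_text bs1"
  have eq: "prog_text bs = ?p @ Sep # b @ prog_text bs2" by (simp add: bs(1) prog_text_def)
  have "mstep (fst s, snd s, [], ?p @ Sep # b @ prog_text bs2)
      (fst s, snd s, ?p @ [Sep], b @ prog_text bs2)"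
    by (rule mstep.intros)
  then have "mstep\<^sup>*\<^sup>* (fst s, snd s, [], prog_text bs)
      (fst t, snd t, (?p @ [Sep]) @ b, prog_text bs2)"
    unfolding eq using micros_msteps[OF assms(2)] by (rule converse_rtranclp_into_rtranclp)
  moreover have "((?p @ [Sep]) @ b) @ prog_text bs2 = prog_text bs" by (simp add: eq)
  moreover have "prog_text bs2 = [] \<or> (\<exists>q'. prog_text bs2 = Sep # q')"
    by (cases bs2) (simp_all add: prog_text_def)
  moreover have "b = last bs \<Longrightarrow> prog_text bs2 = []"
    using bs(2) by (simp add: prog_text_def)
  ultimately show thesis by (rule that)
qed

lemma tape_accepts_msteps:
  assumes "tape_accepts bs s" "bs \<noteq> []"
  shows "\<exists>a b p. mstep\<^sup>*\<^sup>* (fst s, snd s, [], prog_text bs) (a, b, p, [])"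
proof -
  obtain t u where "(\<lambda>s t. \<exists>b\<in>set bs. micros b s t)\<^sup>*\<^sup>* s t" and u: "micros (last bs) t u"
    using assms(1) unfolding tape_accepts_def by blast
  from this(1) show ?thesis
  proof (induction rule: converse_rtranclp_induct)
    case base
    show ?case using block_msteps[OF last_in_set[OF assms(2)] u] by metis
  next
    case (step s s')
    then obtain b where b: "b \<in> set bs" "micros b s s'" by blast
    obtain p q where pq: "mstep\<^sup>*\<^sup>* (fst s, snd s, [], prog_text bs) (fst s', snd s', p, q)"
      "p @ q = prog_text bs" "q = [] \<or> (\<exists>q'. q = Sep # q')"
      using block_msteps[OF b] by metis
    show ?case
    \<comment> \<open>If the end of the program is already reached, the rest of the run is
      dropped.\<close>
    proof (cases "q = []")
      case False
      with pq obtain q' where q: "q = Sep # q'" by blast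
      have "mstep (fst s', snd s', p, Sep # q') (fst s', snd s', [], p @ Sep # q')"
        by (rule mstep.intros)
      with pq q have "mstep\<^sup>*\<^sup>* (fst s, snd s, [], prog_text bs) (fst s', snd s', [], prog_text bs)"
        by (metis rtranclp.rtrancl_into_rtrancl)
      moreover from step.IH obtain a b p where
        "mstep\<^sup>*\<^sup>* (fst s', snd s', [], prog_text bs) (a, b, p, [])" by blast
      ultimately have "mstep\<^sup>*\<^sup>* (fst s, snd s, [], prog_text bs) (a, b, p, [])"
        by (rule rtranclp_trans)
      then show ?thesis by blast
    qed (use pq in blast)
  qed
qed

section \<open>Registers as cells of the tape\<close>

fun op_reg :: "op \<Rightarrow> nat" where
  "op_reg (Inc r) = r"
| "op_reg (Dec r) = r"
| "op_reg (Tst r) = r"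

text \<open>Each operation walks from the first cell to its register and returns, so that the next
  one again finds the head at the left end.\<close>

fun op_text :: "op \<Rightarrow> nat list" where
  "op_text (Inc r) = replicate r Rgt @ [Add, Hom]"
| "op_text (Dec r) = replicate r Rgt @ [Sub, Hom]"
| "op_text (Tst r) = replicate r Rgt @ [Zer, Hom]"

definition cells :: "vec \<Rightarrow> nat list \<Rightarrow> nat list" where
  "cells v rs = concat (map (\<lambda>r. replicate (v r) One @ [Bar]) rs)"

lemma cells_Cons: "cells v (r # rs) = replicate (v r) One @ Bar # cells v rs"
  by (simp add: cells_def)

lemma cells_append: "cells v (rs @ rs') = cells v rs @ cells v rs'"
  by (simp add: cells_def)

lemma cells_upd: "r \<notin> set rs \<Longrightarrow> cells (v(r := x)) rs = cells v rs"
  unfolding cells_def by (intro arg_cong[where f = concat]) auto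

lemma cells_split:
  "r < N \<Longrightarrow> cells v [0..<N] = cells v [0..<r] @ replicate (v r) One @ Bar # cells v [Suc r..<N]"
  by (metis cells_Cons cells_append less_imp_le_nat upt_add_eq_append upt_conv_Cons le_add_diff_inverse zero_le)

lemma replicate_marker_unique:
  "replicate k One @ Bar # b = replicate k' One @ Bar # b' \<longleftrightarrow> k = k' \<and> b = b'"
proof (induction k arbitrary: k')
  case 0
  then show ?case by (cases k') auto
next
  case (Suc k)
  then show ?case by (cases k') auto
qed

lemma micro_right_cell: "micro Rgt (a, replicate k One @ Bar # b) t \<longleftrightarrow> t = (a @ replicate k One @ [Bar], b)"
  unfolding micro_iff by (auto simp: replicate_marker_unique simp del: One_nat_def)

lemma micros_right:
  "r \<le> N \<Longrightarrow> micros (replicate r Rgt) ([], cells v [0..<N]) t \<longleftrightarrow> t = (cells v [0..<r], cells v [r..<N])"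
proof (induction r arbitrary: t)
  case 0
  then show ?case by (simp add: cells_def)
next
  case (Suc r)
  have "replicate (Suc r) Rgt = replicate r Rgt @ [Rgt]" by (simp add: replicate_append_same)
  moreover have "micro Rgt (cells v [0..<r], cells v [r..<N]) u \<longleftrightarrow>
      u = (cells v [0..<Suc r], cells v [Suc r..<N])" for u
  proof -
    have "cells v [r..<N] = replicate (v r) One @ Bar # cells v [Suc r..<N]"
      using Suc.prems by (simp only: upt_conv_Cons Suc_le_eq cells_Cons)
    moreover have "cells v [0..<Suc r] = cells v [0..<r] @ replicate (v r) One @ [Bar]"
      by (simp add: cells_append cells_def)
    ultimately show ?thesis by (simp only: micro_right_cell)
  qed
  ultimately show ?case using Suc by (auto simp: micros_append simp del: replicate_Suc upt_Suc)
qed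

lemma micros_op_text:
  assumes "op_reg x < N"
  shows "micros (op_text x) ([], cells v [0..<N]) t \<longleftrightarrow>
    (\<exists>v'. op_sem x v v' \<and> t = ([], cells v' [0..<N]))"
proof -
  define r where "r = op_reg x"
  have r: "r < N" using assms by (simp add: r_def)
  let ?a = "cells v [0..<r]" and ?b = "cells v [Suc r..<N]"
  have upd: "cells (v(r := y)) [0..<N] = ?a @ replicate y One @ Bar # ?b" for y
    using cells_split[OF r, of "v(r := y)"] by (simp add: cells_upd)
  have b: "cells v [r..<N] = replicate (v r) One @ Bar # ?b"
    using r by (simp only: upt_conv_Cons cells_Cons)
  have right: "micros (replicate r Rgt @ ys) ([], cells v [0..<N]) t \<longleftrightarrow>
      micros ys (?a, replicate (v r) One @ Bar # ?b) t" for ys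
    unfolding micros_append using micros_right[of r N v] r b by auto
  show ?thesis
  proof (cases x)
    case (Inc r')
    then have x: "x = Inc r" by (simp add: r_def)
    show ?thesis
      unfolding x op_text.simps op_sem.simps right
      by (simp add: micro_iff upd del: fun_upd_apply)
  next
    case (Dec r')
    then have x: "x = Dec r" by (simp add: r_def)
    show ?thesis
      unfolding x op_text.simps op_sem.simps right
      by (cases "v r") (auto simp: micro_iff upd simp del: fun_upd_apply)
  next
    case (Tst r')
    then have x: "x = Tst r" by (simp add: r_def)
    show ?thesis
      unfolding x op_text.simps op_sem.simps right
      using cells_split[OF r, of v] by (cases "v r") (auto simp: micro_iff simp del: fun_upd_apply)
  qed
qed

definition block_text :: "op list \<Rightarrow> nat list" where
  "block_text xs = concat (map op_text xs)"

lemma micros_block_text: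
  "\<forall>x\<in>set xs. op_reg x < N \<Longrightarrow> micros (block_text xs) ([], cells v [0..<N]) t \<longleftrightarrow>
    (\<exists>v'. ops_sem xs v v' \<and> t = ([], cells v' [0..<N]))"
proof (induction xs arbitrary: v)
  case (Cons x xs)
  then have x: "op_reg x < N" by simp
  have "micros (block_text (x # xs)) ([], cells v [0..<N]) t \<longleftrightarrow>
      (\<exists>u. (\<exists>v'. op_sem x v v' \<and> u = ([], cells v' [0..<N])) \<and> micros (block_text xs) u t)"
    unfolding micros_op_text[OF x, symmetric] by (simp add: block_text_def micros_append)
  also have "\<dots> \<longleftrightarrow> (\<exists>v'. ops_sem (x # xs) v v' \<and> t = ([], cells v' [0..<N]))"
    unfolding ex_ex_eq_conj using Cons by auto
  finally show ?case .
qed (simp add: block_text_def)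

lemma tape_accepts_block_text:
  assumes regs: "\<forall>b\<in>set bs. \<forall>x\<in>set b. op_reg x < N" and "bs \<noteq> []"
  shows "tape_accepts (map block_text bs) ([], cells v [0..<N]) \<longleftrightarrow> accepts bs v"
proof -
  let ?e = "\<lambda>v. ([], cells v [0..<N])"
  let ?R = "\<lambda>s t. \<exists>b\<in>set (map block_text bs). micros b s t"
  have R_step: "?R (?e v) t \<longleftrightarrow> (\<exists>w. vstep (set bs) v w \<and> t = ?e w)" for v t
    using regs micros_block_text by (auto simp: vstep_def)
  have steps: "?R\<^sup>*\<^sup>* (?e v) t \<longleftrightarrow> (\<exists>w. (vstep (set bs))\<^sup>*\<^sup>* v w \<and> t = ?e w)" for t
  proof
    assume "?R\<^sup>*\<^sup>* (?e v) t"
    then show "\<exists>w. (vstep (set bs))\<^sup>*\<^sup>* v w \<and> t = ?e w"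
    proof (induction rule: rtranclp_induct)
      case (step y z)
      then show ?case using R_step
        by (metis rtranclp.rtrancl_into_rtrancl)
    qed blast
  next
    assume "\<exists>w. (vstep (set bs))\<^sup>*\<^sup>* v w \<and> t = ?e w"
    then obtain w where "(vstep (set bs))\<^sup>*\<^sup>* v w" and t: "t = ?e w" by blast
    from this(1) show "?R\<^sup>*\<^sup>* (?e v) t"
      unfolding t
    proof (induction rule: rtranclp_induct)
      case (step y z)
      from step.hyps(2) have "?R (?e y) (?e z)" unfolding R_step by blast
      with step.IH show ?case by (rule rtranclp.rtrancl_into_rtrancl)
    qed blast
  qed
  have "last bs \<in> set bs" using assms(2) by simp
  then have "\<forall>x\<in>set (last bs). op_reg x < N" using regs by blast
  then have last: "micros (last (map block_text bs)) (?e w) t \<longleftrightarrow>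
      (\<exists>v'. ops_sem (last bs) w v' \<and> t = ?e v')" for w t
    using assms(2) by (simp add: last_map micros_block_text)
  show ?thesis
    unfolding tape_accepts_def accepts_def steps using last by blast
qed

lemma block_text_letters: "set (block_text xs) \<subseteq> {Add..Hom}"
proof -
  have "set (op_text x) \<subseteq> {Add..Hom}" for x by (cases x) auto
  then show ?thesis by (auto simp: block_text_def)
qed

definition machine_word :: "nat \<Rightarrow> op list list \<Rightarrow> vec \<Rightarrow> nat list" where
  "machine_word N bs v = config_word ([], cells v [0..<N], [], prog_text (map block_text bs))"

lemma machine_accepts:
  assumes regs: "\<forall>b\<in>set bs. \<forall>x\<in>set b. op_reg x < N" and "bs \<noteq> []"
  shows "(\<exists>u. (rewr machine)\<^sup>*\<^sup>* (machine_word N bs v) (u @ [Ptr])) \<longleftrightarrow> accepts bs v"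
    and "set (machine_word N bs v) \<subseteq> {..<12}"
proof -
  let ?T = "prog_text (map block_text bs)" and ?c = "cells v [0..<N]"
  have c: "set ?c \<subseteq> {One, Bar}" by (auto simp: cells_def)
  have T: "set ?T \<subseteq> {Add..Sep}"
  proof -
    have "{Add..Hom} \<subseteq> {Add..Sep}" by simp
    then have "set (Sep # block_text b) \<subseteq> {Add..Sep}" for b
      using block_text_letters[of b] by auto
    then show ?thesis by (auto simp: prog_text_def)
  qed
  have wf_config: "wf_config ([], ?c, [], ?T)" using c T by simp
  have sep: "\<forall>b\<in>set (map block_text bs). Sep \<notin> set b"
    using block_text_letters by fastforce
  \<comment> \<open>This is why the target suffix is the single letter \<open>Ptr\<close>: it ends
    the word exactly when no program is left to its right.\<close>
  have final: "(\<exists>u. config_word c' = u @ [Ptr]) \<longleftrightarrow> (\<exists>a b p. c' = (a, b, p, []))"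
    if "mstep\<^sup>*\<^sup>* ([], ?c, [], ?T) c'" for c'
  proof -
    have "wf_config c'" using that by (induction rule: rtranclp_induct) (use wf_config wf_config_mstep in auto)
    obtain a b p q where c': "c' = (a, b, p, q)" by (cases c')
    have "Ptr \<notin> set q" using \<open>wf_config c'\<close> c' by auto
    then show ?thesis
      unfolding c' by (cases q rule: rev_cases) auto
  qed
  have "(\<exists>u. (rewr machine)\<^sup>*\<^sup>* (machine_word N bs v) (u @ [Ptr])) \<longleftrightarrow>
      (\<exists>a b p. mstep\<^sup>*\<^sup>* ([], ?c, [], ?T) (a, b, p, []))"
    unfolding machine_word_def rewrs_enc[OF wf_config] using final by metis
  also have "\<dots> \<longleftrightarrow> tape_accepts (map block_text bs) ([], ?c)"
    using config_accepts_msteps[of "[]" ?c "map block_text bs"] tape_accepts_msteps[of "map block_text bs" "([], ?c)"]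
      sep assms(2) by auto
  also have "\<dots> \<longleftrightarrow> accepts bs v"
    by (rule tape_accepts_block_text[OF assms])
  finally show "(\<exists>u. (rewr machine)\<^sup>*\<^sup>* (machine_word N bs v) (u @ [Ptr])) \<longleftrightarrow> accepts bs v" .
  show "set (machine_word N bs v) \<subseteq> {..<12}"
    using c T by (auto simp: machine_word_def)
qed

section \<open>Undecidability\<close>

lemma rec_eval_Comp1: "rec_eval g xs a \<Longrightarrow> rec_eval f [a] z \<Longrightarrow> rec_eval (Comp f [g]) xs z"
  by (rule rec_eval.Comp[of xs _ "[a]"]) simp_all

lemma rec_eval_Comp2:
  "rec_eval g xs a \<Longrightarrow> rec_eval h xs b \<Longrightarrow> rec_eval f [a, b] z \<Longrightarrow> rec_eval (Comp f [g, h]) xs z"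
  by (rule rec_eval.Comp[of xs _ "[a, b]"]) simp_all

lemma rec_eval_Proj_0: "rec_eval (Proj 0) (x # xs) x"
  and rec_eval_Proj_1: "rec_eval (Proj 1) (y # x # xs) x"
  using rec_eval.Proj[of 0 "x # xs"] rec_eval.Proj[of 1 "y # x # xs"] by simp_all

fun r_const :: "nat \<Rightarrow> recf" where
  "r_const 0 = Zero"
| "r_const (Suc k) = Comp Succ [r_const k]"

lemma rec_eval_const: "rec_eval (r_const k) xs k"
  by (induction k) (simp_all add: rec_eval.Zero rec_eval_Comp1 rec_eval.Succ)

definition r_add :: recf where
  "r_add = Prim (Proj 0) (Comp Succ [Proj 1])"

lemma rec_eval_add: "rec_eval r_add [m, n] (m + n)"
  unfolding r_add_def
proof (induction m)
  case 0
  show ?case by (simp add: rec_eval.Prim_0 rec_eval_Proj_0)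
next
  case (Suc m)
  show ?case unfolding add_Suc
    by (rule rec_eval.Prim_Suc[OF Suc]) (rule rec_eval_Comp1[OF rec_eval_Proj_1 rec_eval.Succ])
qed

definition r_triangle :: recf where
  "r_triangle = Prim Zero (Comp r_add [Comp Succ [Proj 0], Proj 1])"

lemma rec_eval_triangle: "rec_eval r_triangle [n] (triangle n)"
  unfolding r_triangle_def
proof (induction n)
  case 0
  show ?case by (simp add: rec_eval.Prim_0 rec_eval.Zero)
next
  case (Suc n)
  have "triangle (Suc n) = Suc n + triangle n" by simp
  then show ?case
    by (simp only:) (rule rec_eval.Prim_Suc[OF Suc], rule rec_eval_Comp2[OF
        rec_eval_Comp1[OF rec_eval_Proj_0 rec_eval.Succ] rec_eval_Proj_1 rec_eval_add])
qed

text \<open>Follows the formula \<open>triangle (m + n) + m\<close> for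
  \<open>prod_encode (m, n)\<close>.\<close>

definition r_pair :: "recf \<Rightarrow> recf \<Rightarrow> recf" where
  "r_pair f g = Comp r_add [Comp r_triangle [Comp r_add [f, g]], f]"

lemma rec_eval_pair:
  assumes "rec_eval f xs m" "rec_eval g xs n"
  shows "rec_eval (r_pair f g) xs (prod_encode (m, n))"
  unfolding r_pair_def prod_encode_def prod.case
  by (intro rec_eval_Comp2[OF _ _ rec_eval_add] rec_eval_Comp1[OF _ rec_eval_triangle] assms)

text \<open>The effect on \<open>word_code\<close> of prepending the positive letter
  \<open>k\<close>; the inner \<open>1\<close> codes its exponent \<open>True\<close>.\<close>

definition cons_code :: "nat \<Rightarrow> nat \<Rightarrow> nat" where
  "cons_code k r = Suc (prod_encode (prod_encode (k, 1), r))"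

definition r_cons :: "nat \<Rightarrow> recf \<Rightarrow> recf" where
  "r_cons k f = Comp Succ [r_pair (r_const (prod_encode (k, 1))) f]"

lemma rec_eval_cons: "rec_eval f xs r \<Longrightarrow> rec_eval (r_cons k f) xs (cons_code k r)"
  unfolding r_cons_def cons_code_def
  by (intro rec_eval_Comp1[OF _ rec_eval.Succ] rec_eval_pair rec_eval_const)

definition r_iter :: "nat \<Rightarrow> recf" where
  "r_iter k = Prim (Proj 0) (r_cons k (Proj 1))"

lemma rec_eval_iter: "rec_eval (r_iter k) [n, x] ((cons_code k ^^ n) x)"
  unfolding r_iter_def
proof (induction n)
  case 0
  show ?case by (simp add: rec_eval.Prim_0 rec_eval_Proj_0)
next
  case (Suc n)
  show ?case unfolding funpow.simps comp_apply
    by (rule rec_eval.Prim_Suc[OF Suc]) (intro rec_eval_cons rec_eval_Proj_1)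
qed

lemma word_code_Cons: "word_code (pos_word (k # w)) = cons_code k (word_code (pos_word w))"
  by (simp add: word_code_def pos_word_def cons_code_def)

lemma word_code_replicate:
  "word_code (pos_word (replicate n k @ w)) = (cons_code k ^^ n) (word_code (pos_word w))"
  by (induction n) (simp_all add: word_code_Cons)

text \<open>Only register \<open>0\<close> of \<open>init_vec x\<close> depends on \<open>x\<close>,
  so all that follows the \<open>One\<close>s is a constant tail.\<close>

lemma machine_word_init:
  "0 < N \<Longrightarrow> machine_word N bs (init_vec x) = Dol # Cur # replicate x One @
     Bar # cells (init_vec 0) [1..<N] @ Pct # Ptr # prog_text (map block_text bs)"
proof -
  assume "0 < N"
  then have "[0..<N] = 0 # [1..<N]" by (simp add: upt_rec)
  moreover have "cells (init_vec x) [1..<N] = cells (init_vec 0) [1..<N]"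
    unfolding cells_def by (intro arg_cong[where f = concat]) (auto simp: init_vec_def)
  ultimately show ?thesis
    by (simp add: machine_word_def cells_Cons init_vec_def)
qed

text \<open>The argument \<open>x\<close> is represented in unary, so that the code of the initial word is computable
  from the code \<open>x\<close> of its tail by iterating \<open>cons_code\<close>.\<close>

lemma recf_machine_word:
  obtains t where
    "\<And>x. (\<exists>u. (rewr machine)\<^sup>*\<^sup>* (Dol # Cur # replicate x One @ t) (u @ [Ptr])) \<longleftrightarrow> (\<exists>y. rec_eval p [x] y)"
    "\<And>x. set (Dol # Cur # replicate x One @ t) \<subseteq> {..<12}"
proof -
  define bs where "bs = recf_blocks p"
  have bs: "bs \<noteq> []" by (simp add: bs_def recf_blocks_def)
  have "finite (\<Union>b\<in>set bs. op_reg ` set b)" by simp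
  then obtain M where "\<forall>r\<in>(\<Union>b\<in>set bs. op_reg ` set b). r < M"
    using finite_nat_set_iff_bounded by blast
  \<comment> \<open>\<open>Suc M\<close> rather than \<open>M\<close> makes the number of cells
    positive, so that the cell of the argument exists.\<close>
  then have regs: "\<forall>b\<in>set bs. \<forall>x\<in>set b. op_reg x < Suc M" by (simp add: less_Suc_eq)
  show thesis
    by (rule that[of "Bar # cells (init_vec 0) [1..<Suc M] @ Pct # Ptr # prog_text (map block_text bs)"])
      (unfold machine_word_init[OF zero_less_Suc, symmetric] machine_accepts(1)[OF regs bs],
        simp_all only: bs_def accepts_recf_blocks machine_accepts(2)[OF regs bs, unfolded bs_def])
qed

theorem theorem2:
  shows "\<exists>(\<Sigma> :: nat set) R. finite \<Sigma> \<and> rational_subset \<Sigma> R \<and> \<not> pcp_decidable \<Sigma> R"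
proof -
  \<comment> \<open>The machine uses the symbols from \<open>0\<close> to \<open>11\<close>, which
    leaves \<open>12\<close> as the marker.\<close>
  have letters: "\<And>l r l' r'. ((l, r), (l', r')) \<in> set machine \<Longrightarrow>
      set l \<subseteq> {..<12} \<and> set r \<subseteq> {..<12} \<and> set l' \<subseteq> {..<12} \<and> set r' \<subseteq> {..<12}"
    by (auto simp: machine_def)
  have "set [Ptr] \<subseteq> {..<12}" by simp
  from rewriting_to_pcp[OF letters this] obtain \<Sigma> :: "nat set" and R a b c where \<Sigma>: "finite \<Sigma>" "rational_subset \<Sigma> R"
    and inst: "\<And>w. set w \<subseteq> {..<12} \<Longrightarrow> \<exists>\<Delta> g h. finite \<Delta> \<and>
      g \<in> hom (free_group \<Sigma>) (free_group \<Delta>) \<and> h \<in> hom (free_group \<Sigma>) (free_group \<Delta>) \<and>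
      pcp_code \<Sigma> \<Delta> g h =
        prod_encode (a, prod_encode (Suc (prod_encode (word_code (pos_word (w @ [12])), b)), c)) \<and>
      (pcp_solvable \<Sigma> R g h \<longleftrightarrow> (\<exists>u. (rewr machine)\<^sup>*\<^sup>* w (u @ [Ptr])))"
    by metis
  have "\<not> pcp_decidable \<Sigma> R"
  proof
    assume "pcp_decidable \<Sigma> R"
    then obtain f where f: "\<And>\<Delta> g h. finite \<Delta> \<Longrightarrow> g \<in> hom (free_group \<Sigma>) (free_group \<Delta>) \<Longrightarrow>
        h \<in> hom (free_group \<Sigma>) (free_group \<Delta>) \<Longrightarrow>
        rec_eval f [pcp_code \<Sigma> \<Delta> g h] (of_bool (pcp_solvable \<Sigma> R g h))"
      unfolding pcp_decidable_def by blast
    define red where "red = r_pair (r_const a) (r_pair (Comp Succ [r_pair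
      (r_cons Dol (r_cons Cur (Comp (r_iter One) [Proj 0, Proj 0]))) (r_const b)]) (r_const c))"
    \<comment> \<open>\<open>Proj 1\<close> does not look at the search variable, so
      \<open>Mu (Proj 1)\<close> is \<open>0\<close> at the argument \<open>0\<close> and undefined
      at \<open>1\<close>: \<open>d\<close> halts on the answer no and diverges on the answer
      yes.\<close>
    define d where "d = Comp (Mu (Proj 1)) [Comp f [red]]"
    obtain t where t: "\<And>x. (\<exists>u. (rewr machine)\<^sup>*\<^sup>* (Dol # Cur # replicate x One @ t) (u @ [Ptr])) \<longleftrightarrow>
        (\<exists>y. rec_eval d [x] y)" "\<And>x. set (Dol # Cur # replicate x One @ t) \<subseteq> {..<12}"
      using recf_machine_word[of d] by blast
    \<comment> \<open>There is no circularity, as \<open>t\<close> depends on \<open>d\<close> but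
      not on the argument. Now \<open>x\<close> is both the number of \<open>One\<close>s and the
      code of what follows them, which is why \<open>red\<close> passes \<open>Proj 0\<close> twice
      to \<open>r_iter One\<close>.\<close>
    define x where "x = word_code (pos_word (t @ [12]))"
    obtain \<Delta> g h where fin: "finite \<Delta>"
      and hom: "g \<in> hom (free_group \<Sigma>) (free_group \<Delta>)" "h \<in> hom (free_group \<Sigma>) (free_group \<Delta>)"
      and code: "pcp_code \<Sigma> \<Delta> g h = prod_encode (a, prod_encode (Suc (prod_encode
        (word_code (pos_word ((Dol # Cur # replicate x One @ t) @ [12])), b)), c))"
      and solvable: "pcp_solvable \<Sigma> R g h \<longleftrightarrow> (\<exists>y. rec_eval d [x] y)"
      using inst[OF t(2)[of x]] unfolding t(1) by blast
    have word: "word_code (pos_word ((Dol # Cur # replicate x One @ t) @ [12])) =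
        cons_code Dol (cons_code Cur ((cons_code One ^^ x) x))"
      unfolding append_Cons append_assoc word_code_Cons word_code_replicate x_def ..
    have "rec_eval red [x] (pcp_code \<Sigma> \<Delta> g h)"
      unfolding code word red_def
      by (intro rec_eval_pair rec_eval_const rec_eval_Comp1[OF _ rec_eval.Succ] rec_eval_cons
        rec_eval_Comp2[OF _ _ rec_eval_iter] rec_eval_Proj_0)
    then have answer: "rec_eval (Comp f [red]) [x] (of_bool (\<exists>y. rec_eval d [x] y))"
      using f[OF fin hom] unfolding solvable by (rule rec_eval_Comp1)
    show False
    proof (cases "\<exists>y. rec_eval d [x] y")
      case True
      then obtain y where "rec_eval d [x] y" ..
      then obtain v where v: "rec_eval (Comp f [red]) [x] v" "rec_eval (Mu (Proj 1)) [v] y"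
        by (auto simp: d_def rec_eval_Comp_iff list_all2_Cons1)
      from v(1) answer True have "v = 1" by (auto dest: rec_eval_deterministic)
      with v(2) show False by (auto simp: rec_eval_Mu_iff rec_eval_Proj_iff)
    next
      case False
      with answer have "rec_eval (Comp f [red]) [x] 0" by simp
      moreover have "rec_eval (Mu (Proj 1)) [0] 0"
        by (auto simp: rec_eval_Mu_iff rec_eval_Proj_iff)
      ultimately have "rec_eval d [x] 0"
        unfolding d_def by (rule rec_eval_Comp1)
      with False show False by blast
    qed
  qed
  with \<Sigma> show ?thesis by blast
qed

end
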